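(* For every $\gamma\in[0,1]$, the policy $\mathsf{SAMP}(\gamma)$ satisfies: (1) on every instance of MP-KHD, $\mathbb{E}[\text{profit of }\mathsf{SAMP}(\gamma)]\ge\gamma(1-\gamma)\cdot\mathrm{OPT\text{-}OFF}$; (2) on every instance, the total number $H$ of successful assignments satisfies $\mathrm{Var}[H]\le\bar\gamma(1-\bar\gamma)B$, where $\bar\gamma=\min(1/2,\gamma)$ and $B=\sum_{i\in I}b_i$. Both bounds are tight, measured directly against $\mathrm{OPT\text{-}OFF}$: $\inf$ over instances of $\mathbb{E}[\text{profit of }\mathsf{SAMP}(\gamma)]/\mathrm{OPT\text{-}OFF}$ equals $\gamma(1-\gamma)$, and for every positive integer $B$ there is an instance with $\sum_i b_i=B$ on which $\mathrm{Var}[H]=\bar\gamma(1-\bar\gamma)B$.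
   Context: An instance of MP-KHD consists of: a bipartite graph $G=(I,J,E)$ with finite sets $I$ (offline agent types) and $J$ (online agent types); a finite set of prices $\{a_1,\dots,a_K\}$; a capacity $b_i\in\mathbb{Z}_{>0}$ for each $i\in I$; a horizon $T\in\mathbb{Z}_{>0}$; for each $t\in[T]$ a probability distribution $(q_{j,t})_{j\in J}$ on $J$; the assignment set $\mathcal{F}=\{(i,j,k):(i,j)\in E,k\in[K]\}$; for each $f\in\mathcal{F}$, $t\in[T]$, an acceptance probability $p_{f,t}\in(0,1]$ and profit $w_{f,t}\ge0$. $\mathcal{F}_j$ ($\mathcal{F}_i$) is the set of assignments with second (first) coordinate $j$ ($i$). The instance is known in advance. In each round $t$, an online agent type $\hat j_t$ arrives, independently across rounds, with $\Pr[\hat j_t=j]=q_{j,t}$; the policy irrevocably rejects it or selects one $f=(i,\hat j_t,k)\in\mathcal{F}_{\hat j_t}$ with $i$ having remaining capacity; the agent independently accepts with probability $p_{f,t}$ (then $i$'s capacity drops by one and profit $w_{f,t}$ is earned), else nothing happens. A successful assignment is one selected and accepted. $\mathrm{OPT\text{-}OFF}$ is the maximum expected total profit of a clairvoyant policy that observes the whole arrival sequence before deciding. All expectations/variances are over arrivals, the policy's internal randomness, and acceptance outcomes. Policy $\mathsf{SAMP}(\gamma)$, $\gamma\in[0,1]$: replace each offline type $i$ by $b_i$ copies of capacity 1 (inheriting $i$'s edges, probabilities and profits), and work with this unit-capacity instance. Solve the LP $\max\sum_{t,f}x_{f,t}p_{f,t}w_{f,t}$ s.t. $\sum_{f\in\mathcal{F}_j}x_{f,t}\le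 q_{j,t}$ for all $j,t$; $\sum_t\sum_{f\in\mathcal{F}_i}x_{f,t}p_{f,t}\le1$ for all $i$; $x\ge0$; let $x$ be an optimal solution. In round $t$, when $j$ arrives, sample at most one assignment, choosing each $f\in\mathcal{F}_j$ with probability $\gamma x_{f,t}/q_{j,t}$; if some $f=(i,j,k)$ is sampled and $i$ still has its unit of capacity, select $f$; otherwise reject. *)

theory Defs
  imports "HOL-Probability.Probability" "HOL-Probability.Product_PMF"
begin

(* An assignment (i, j, k) offers the k-th price to an online agent of type j, matched to the
   offline type i. *)
type_synonym ('i, 'j) assignment = "'i \<times> 'j \<times> nat"

(* Rounds and price indices are numbered from 0, so that [T] is {..<T} and [K] is {..<K}.
   The numerical prices influence the process only through accept_prob and profit. *)
record ('i, 'j) mpkhd =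
  offline :: "'i set"
  online :: "'j set"
  edges :: "('i \<times> 'j) set"
  prices :: "real list"
  capacity :: "'i \<Rightarrow> nat"
  horizon :: nat
  arrival :: "nat \<Rightarrow> 'j pmf"
  accept_prob :: "('i, 'j) assignment \<Rightarrow> nat \<Rightarrow> real"
  profit :: "('i, 'j) assignment \<Rightarrow> nat \<Rightarrow> real"

definition assignments :: "('i, 'j) mpkhd \<Rightarrow> ('i, 'j) assignment set" where
  "assignments M = {(i, j, k). (i, j) \<in> edges M \<and> k < length (prices M)}"

definition assignments_on :: "('i, 'j) mpkhd \<Rightarrow> 'j \<Rightarrow> ('i, 'j) assignment set" where
  "assignments_on M j = {(i, j', k) \<in> assignments M. j' = j}"

definition assignments_off :: "('i, 'j) mpkhd \<Rightarrow> 'i \<Rightarrow> ('i, 'j) assignment set" where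
  "assignments_off M i = {(i', j, k) \<in> assignments M. i' = i}"

definition mpkhd_instance :: "('i, 'j) mpkhd \<Rightarrow> bool" where
  "mpkhd_instance M \<longleftrightarrow>
     finite (offline M) \<and> finite (online M) \<and> edges M \<subseteq> offline M \<times> online M \<and>
     distinct (prices M) \<and>
     (\<forall>i\<in>offline M. capacity M i > 0) \<and>
     horizon M > 0 \<and>
     (\<forall>t<horizon M. set_pmf (arrival M t) \<subseteq> online M) \<and>
     (\<forall>f\<in>assignments M. \<forall>t<horizon M.
        0 < accept_prob M f t \<and> accept_prob M f t \<le> 1 \<and> 0 \<le> profit M f t)"

definition total_capacity :: "('i, 'j) mpkhd \<Rightarrow> nat" where
  "total_capacity M = (\<Sum>i\<in>offline M. capacity M i)"


(* A history lists, for each past round, the policy's decision (None is rejection) and whether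
   the selected assignment was accepted; its length is the number of the current round. *)
type_synonym ('i, 'j) history = "(('i, 'j) assignment option \<times> bool) list"

definition uses :: "('i, 'j) history \<Rightarrow> 'i \<Rightarrow> nat" where
  "uses h i = card {s. s < length h \<and> (\<exists>j k. h ! s = (Some (i, j, k), True))}"

definition successes :: "('i, 'j) history \<Rightarrow> nat" where
  "successes h = card {s. s < length h \<and> (\<exists>f. h ! s = (Some f, True))}"

definition total_profit :: "('i, 'j) mpkhd \<Rightarrow> ('i, 'j) history \<Rightarrow> real" where
  "total_profit M h =
     (\<Sum>s<length h. case h ! s of (Some f, True) \<Rightarrow> profit M f s | _ \<Rightarrow> 0)"

definition allowed_decisions ::
  "('i, 'j) mpkhd \<Rightarrow> 'j \<Rightarrow> ('i, 'j) history \<Rightarrow> ('i, 'j) assignment option set" where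
  "allowed_decisions M j h =
     insert None (Some ` {f \<in> assignments_on M j. uses h (fst f) < capacity M (fst f)})"

(* A (randomized) policy maps the arrival sequence and the history to a distribution of the
   current decision. *)
type_synonym ('i, 'j) policy =
  "(nat \<Rightarrow> 'j) \<Rightarrow> ('i, 'j) history \<Rightarrow> ('i, 'j) assignment option pmf"

fun acceptance :: "('i, 'j) mpkhd \<Rightarrow> nat \<Rightarrow> ('i, 'j) assignment option \<Rightarrow> bool pmf" where
  "acceptance M t None = return_pmf False"
| "acceptance M t (Some f) = bernoulli_pmf (accept_prob M f t)"

fun run ::
  "('i, 'j) mpkhd \<Rightarrow> ('i, 'j) policy \<Rightarrow> (nat \<Rightarrow> 'j) \<Rightarrow> nat \<Rightarrow> ('i, 'j) history pmf" where
  "run M \<pi> js 0 = return_pmf []"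
| "run M \<pi> js (Suc t) =
     bind_pmf (run M \<pi> js t) (\<lambda>h.
     bind_pmf (\<pi> js h) (\<lambda>d.
     map_pmf (\<lambda>a. h @ [(d, a)]) (acceptance M t d)))"

definition arrivals :: "('i, 'j) mpkhd \<Rightarrow> (nat \<Rightarrow> 'j) pmf" where
  "arrivals M = Pi_pmf {..<horizon M} undefined (arrival M)"

definition outcome :: "('i, 'j) mpkhd \<Rightarrow> ('i, 'j) policy \<Rightarrow> ('i, 'j) history pmf" where
  "outcome M \<pi> = bind_pmf (arrivals M) (\<lambda>js. run M \<pi> js (horizon M))"

definition expected_profit :: "('i, 'j) mpkhd \<Rightarrow> ('i, 'j) policy \<Rightarrow> real" where
  "expected_profit M \<pi> = measure_pmf.expectation (outcome M \<pi>) (total_profit M)"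

definition variance_successes :: "('i, 'j) mpkhd \<Rightarrow> ('i, 'j) policy \<Rightarrow> real" where
  "variance_successes M \<pi> = measure_pmf.variance (outcome M \<pi>) (\<lambda>h. real (successes h))"


(* A clairvoyant policy may use the whole arrival sequence in every round, but it learns the
   acceptance outcomes only as its selections are made. *)
definition clairvoyant_policy :: "('i, 'j) mpkhd \<Rightarrow> ('i, 'j) policy \<Rightarrow> bool" where
  "clairvoyant_policy M \<pi> \<longleftrightarrow>
     (\<forall>js h. length h < horizon M \<longrightarrow>
        set_pmf (\<pi> js h) \<subseteq> allowed_decisions M (js (length h)) h)"

definition opt_off :: "('i, 'j) mpkhd \<Rightarrow> real" where
  "opt_off M = (SUP \<pi>\<in>Collect (clairvoyant_policy M). expected_profit M \<pi>)"


(* The copies of the offline type i are (i, 0), ..., (i, b_i - 1). *)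
definition unit_split :: "('i, 'j) mpkhd \<Rightarrow> ('i \<times> nat, 'j) mpkhd" where
  "unit_split M =
     \<lparr>offline = {(i, n). i \<in> offline M \<and> n < capacity M i},
      online = online M,
      edges = {((i, n), j). (i, j) \<in> edges M \<and> n < capacity M i},
      prices = prices M,
      capacity = (\<lambda>_. 1),
      horizon = horizon M,
      arrival = arrival M,
      accept_prob = (\<lambda>((i, n), j, k). accept_prob M (i, j, k)),
      profit = (\<lambda>((i, n), j, k). profit M (i, j, k))\<rparr>"

(* The right-hand side 1 in the offline constraint is meant for unit-capacity instances. *)
definition lp_feasible ::
  "('i, 'j) mpkhd \<Rightarrow> (('i, 'j) assignment \<Rightarrow> nat \<Rightarrow> real) \<Rightarrow> bool" where
  "lp_feasible U x \<longleftrightarrow>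
     (\<forall>j\<in>online U. \<forall>t<horizon U. (\<Sum>f\<in>assignments_on U j. x f t) \<le> pmf (arrival U t) j) \<and>
     (\<forall>i\<in>offline U.
        (\<Sum>t<horizon U. \<Sum>f\<in>assignments_off U i. x f t * accept_prob U f t) \<le> 1) \<and>
     (\<forall>f\<in>assignments U. \<forall>t<horizon U. 0 \<le> x f t)"

definition lp_value ::
  "('i, 'j) mpkhd \<Rightarrow> (('i, 'j) assignment \<Rightarrow> nat \<Rightarrow> real) \<Rightarrow> real" where
  "lp_value U x = (\<Sum>t<horizon U. \<Sum>f\<in>assignments U. x f t * accept_prob U f t * profit U f t)"

definition lp_optimal ::
  "('i, 'j) mpkhd \<Rightarrow> (('i, 'j) assignment \<Rightarrow> nat \<Rightarrow> real) \<Rightarrow> bool" where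
  "lp_optimal U x \<longleftrightarrow> lp_feasible U x \<and> (\<forall>y. lp_feasible U y \<longrightarrow> lp_value U y \<le> lp_value U x)"

definition sample_assignment ::
  "real \<Rightarrow> ('i, 'j) mpkhd \<Rightarrow> (('i, 'j) assignment \<Rightarrow> nat \<Rightarrow> real) \<Rightarrow> 'j \<Rightarrow> nat \<Rightarrow>
   ('i, 'j) assignment option pmf" where
  "sample_assignment \<gamma> U x j t = embed_pmf (\<lambda>s. case s of
       None \<Rightarrow> 1 - (\<Sum>f\<in>assignments_on U j. \<gamma> * x f t / pmf (arrival U t) j)
     | Some f \<Rightarrow> if f \<in> assignments_on U j then \<gamma> * x f t / pmf (arrival U t) j else 0)"

(* Of the arrival sequence, only the entry of the current round is used. *)
definition samp_policy ::
  "real \<Rightarrow> ('i, 'j) mpkhd \<Rightarrow> (('i, 'j) assignment \<Rightarrow> nat \<Rightarrow> real) \<Rightarrow> ('i, 'j) policy" where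
  "samp_policy \<gamma> U x = (\<lambda>js h.
     map_pmf (\<lambda>s. case s of
         None \<Rightarrow> None
       | Some f \<Rightarrow> if uses h (fst f) < capacity U (fst f) then Some f else None)
       (sample_assignment \<gamma> U x (js (length h)) (length h)))"

(* SAMP on M, executed in the unit-capacity instance with LP solution x. *)
definition samp_profit ::
  "real \<Rightarrow> ('i, 'j) mpkhd \<Rightarrow> (('i \<times> nat, 'j) assignment \<Rightarrow> nat \<Rightarrow> real) \<Rightarrow> real" where
  "samp_profit \<gamma> M x = expected_profit (unit_split M) (samp_policy \<gamma> (unit_split M) x)"

definition samp_variance ::
  "real \<Rightarrow> ('i, 'j) mpkhd \<Rightarrow> (('i \<times> nat, 'j) assignment \<Rightarrow> nat \<Rightarrow> real) \<Rightarrow> real" where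
  "samp_variance \<gamma> M x = variance_successes (unit_split M) (samp_policy \<gamma> (unit_split M) x)"

(* The LP may have several optimal solutions; a solver fixes one for every instance. *)
definition lp_solver ::
  "(('i, 'j) mpkhd \<Rightarrow> ('i \<times> nat, 'j) assignment \<Rightarrow> nat \<Rightarrow> real) \<Rightarrow> bool" where
  "lp_solver sol \<longleftrightarrow> (\<forall>M. mpkhd_instance M \<longrightarrow> lp_optimal (unit_split M) (sol M))"


lemma finite_assignments: "mpkhd_instance M \<Longrightarrow> finite (assignments M)"
  by (rule finite_subset[of _ "offline M \<times> online M \<times> {..<length (prices M)}"])
     (auto simp: assignments_def mpkhd_instance_def)

lemma mpkhd_instance_unit_split:
  assumes "mpkhd_instance M"
  shows "mpkhd_instance (unit_split M)"
proof -
  have "finite (offline (unit_split M))"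
  proof (rule finite_subset)
    show "offline (unit_split M) \<subseteq> (\<Union>i\<in>offline M. {i} \<times> {..<capacity M i})"
      by (auto simp: unit_split_def)
    show "finite (\<Union>i\<in>offline M. {i} \<times> {..<capacity M i})"
      using assms by (auto simp: mpkhd_instance_def)
  qed
  moreover have "(\<forall>f\<in>assignments (unit_split M). \<forall>t<horizon (unit_split M).
        0 < accept_prob (unit_split M) f t \<and> accept_prob (unit_split M) f t \<le> 1 \<and>
        0 \<le> profit (unit_split M) f t)"
    using assms by (auto simp: mpkhd_instance_def unit_split_def assignments_def)
  ultimately show ?thesis
    using assms by (auto simp: mpkhd_instance_def unit_split_def)
qed

lemma compact_function_box:
  fixes B :: "'a \<Rightarrow> 'b::topological_space set"
  assumes "\<And>a. compact (B a)"
  shows "compact {x. \<forall>a. x a \<in> B a}"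
proof -
  have "compactin (product_topology (\<lambda>_. euclidean) UNIV) (PiE UNIV B)"
    using assms by (simp add: compactin_PiE)
  moreover have "PiE UNIV B = {x. \<forall>a. x a \<in> B a}"
    by auto
  ultimately show ?thesis
    by (simp add: euclidean_product_topology)
qed

lemma lp_optimal_exists:
  assumes M: "mpkhd_instance M"
  shows "\<exists>x. lp_optimal (unit_split M) x"
proof -
  define U where "U = unit_split M"
  have U: "mpkhd_instance U"
    unfolding U_def by (rule mpkhd_instance_unit_split[OF M])
  have fin: "finite (assignments U)" "finite (assignments_on U j)" "finite (assignments_off U i)"
    for i j
    using finite_assignments[OF U]
    by (auto simp: assignments_on_def assignments_off_def intro: finite_subset)
  define box where "box = {x :: _ \<Rightarrow> nat \<Rightarrow> real. \<forall>f. x f \<in> {y. \<forall>t. y t \<in>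
    (if f \<in> assignments U \<and> t < horizon U then {0..1} else {0})}}"
  define P where "P = {x. lp_feasible U x} \<inter> box"
  have coord: "continuous_on UNIV (\<lambda>x :: _ \<Rightarrow> nat \<Rightarrow> real. x f t)" for f :: "('a \<times> nat, 'b) assignment" and t
  proof (rule continuous_on_product_then_coordinatewise)
    show "continuous_on UNIV (\<lambda>x :: ('a \<times> nat, 'b) assignment \<Rightarrow> nat \<Rightarrow> real. x f)"
      by (rule continuous_on_product_coordinates)
  qed
  have "compact box"
    unfolding box_def by (intro compact_function_box) auto
  moreover have "closed {x. lp_feasible U x}"
    unfolding lp_feasible_def Ball_def
    by (intro closed_Collect_conj closed_Collect_all closed_Collect_imp closed_Collect_le
          continuous_intros coord open_Collect_const)
  ultimately have "compact P"
    unfolding P_def by (simp add: closed_Int_compact)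
  moreover have "P \<noteq> {}"
  proof -
    have "(\<lambda>_ _. 0) \<in> P"
      by (auto simp: P_def box_def lp_feasible_def)
    then show ?thesis by blast
  qed
  moreover have "continuous_on P (lp_value U)"
    unfolding lp_value_def
    by (intro continuous_intros continuous_on_subset[OF coord]) auto
  ultimately obtain x where x: "x \<in> P" "\<And>y. y \<in> P \<Longrightarrow> lp_value U y \<le> lp_value U x"
    using continuous_attains_sup by metis
  have "lp_value U y \<le> lp_value U x" if y: "lp_feasible U y" for y
  proof -
    define z where "z = (\<lambda>f t. if f \<in> assignments U \<and> t < horizon U then y f t else 0)"
    have eq: "z f t = y f t" if "f \<in> assignments U" "t < horizon U" for f t
      using that by (simp add: z_def)
    have sub: "assignments_on U j \<subseteq> assignments U" "assignments_off U i \<subseteq> assignments U" for i j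
      by (auto simp: assignments_on_def assignments_off_def)
    have on: "(\<Sum>f\<in>assignments_on U j. z f t) = (\<Sum>f\<in>assignments_on U j. y f t)"
      if "t < horizon U" for j t
      using that by (intro sum.cong refl eq subsetD[OF sub(1)])
    have off: "(\<Sum>t<horizon U. \<Sum>f\<in>assignments_off U i. z f t * accept_prob U f t) =
               (\<Sum>t<horizon U. \<Sum>f\<in>assignments_off U i. y f t * accept_prob U f t)" for i
      by (intro sum.cong refl arg_cong2[where f = "(*)"] eq subsetD[OF sub(2)]) auto
    have feas: "lp_feasible U z"
      using y unfolding lp_feasible_def by (simp add: on off eq)
    have "y f t \<in> {0..1}" if f: "f \<in> assignments U" and t: "t < horizon U" for f t
    proof -
      obtain i j k where fe: "f = (i, j, k)" by (cases f)
      have j: "j \<in> online U" "f \<in> assignments_on U j"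
        using f U by (auto simp: fe assignments_def assignments_on_def mpkhd_instance_def)
      have "y f t \<le> (\<Sum>f\<in>assignments_on U j. y f t)"
        using y j t sub fin by (intro member_le_sum) (auto simp: lp_feasible_def subset_iff)
      also have "\<dots> \<le> pmf (arrival U t) j"
        using y j t by (auto simp: lp_feasible_def)
      also have "\<dots> \<le> 1"
        by (rule pmf_le_1)
      finally show ?thesis
        using y f t by (auto simp: lp_feasible_def)
    qed
    then have "z \<in> P"
      using feas by (auto simp: P_def box_def z_def)
    moreover have "lp_value U z = lp_value U y"
      unfolding lp_value_def by (intro sum.cong) (auto simp: eq)
    ultimately show ?thesis
      using x(2)[of z] by simp
  qed
  then show ?thesis
    using x(1) by (auto simp: U_def P_def lp_optimal_def)
qed

end

theory Submission
  imports Defs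
begin

text \<open>The selection probabilities of a clairvoyant policy, split evenly among the copies, form a
  feasible LP solution, hence the LP value is at least the clairvoyant optimum.

  SAMP draws its samples and the acceptances independently of the past, so a set \<open>C\<close> of copies is
  unused after \<open>t\<close> rounds with probability \<open>\<Prod>s<t. 1 - r C s\<close>, where \<open>r C s\<close> is the probability that an
  accepted assignment to \<open>C\<close> is sampled in round \<open>s\<close>. For a single copy the \<open>r {i} s\<close> sum to at most
  \<open>\<gamma>\<close>, so it is still unused with probability at least \<open>1 - \<gamma>\<close>; this gives the profit bound and
  the variance bound \<open>min (1/2) \<gamma> * (1 - min (1/2) \<gamma>)\<close> for one copy. For two copies,
  \<open>1 - r {i} s - r {k} s \<le> (1 - r {i} s) * (1 - r {k} s)\<close> shows that their successes are negatively
  correlated, so the variances add up to a bound for the total.\<close>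

section \<open>Histories of a clairvoyant policy\<close>

lemma finite_assignments_on: "mpkhd_instance M \<Longrightarrow> finite (assignments_on M j)"
  using finite_assignments[of M] by (auto simp: assignments_on_def intro: finite_subset)

lemma finite_assignments_off: "mpkhd_instance M \<Longrightarrow> finite (assignments_off M i)"
  using finite_assignments[of M] by (auto simp: assignments_off_def intro: finite_subset)

lemma assignments_on_subset: "assignments_on M j \<subseteq> assignments M"
  by (auto simp: assignments_on_def)

lemma assignments_off_subset: "assignments_off M i \<subseteq> assignments M"
  by (auto simp: assignments_off_def)

lemma uses_Nil [simp]: "uses [] i = 0"
  by (simp add: uses_def)

text \<open>Turns the counts \<open>uses\<close> and \<open>successes\<close> into sums of
  indicators, to which linearity of expectation applies.\<close>

lemma card_lessThan_eq_sum:
  "real (card {s. s < (n :: nat) \<and> P s}) = (\<Sum>s<n. of_bool (P s))"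
  by (subst sum_of_bool_eq) (auto intro!: arg_cong[where f = card])

lemma real_uses: "real (uses h i) = (\<Sum>s<length h. of_bool (\<exists>j k. h ! s = (Some (i, j, k), True)))"
  unfolding uses_def by (rule card_lessThan_eq_sum)

lemma real_successes: "real (successes h) = (\<Sum>s<length h. of_bool (\<exists>f. h ! s = (Some f, True)))"
  unfolding successes_def by (rule card_lessThan_eq_sum)

lemma uses_snoc:
  "uses (h @ [x]) i = uses h i + of_bool (\<exists>j k. x = (Some (i, j, k), True))"
proof -
  have "real (uses (h @ [x]) i) = real (uses h i) + of_bool (\<exists>j k. x = (Some (i, j, k), True))"
    by (simp add: real_uses nth_append del: sum_of_bool_eq cong: sum.cong_simp)
  then show ?thesis
    by (cases "\<exists>j k. x = (Some (i, j, k), True)") simp_all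
qed

lemma clairvoyant_allowed:
  assumes "clairvoyant_policy M \<pi>" and "length h < horizon M" and "d \<in> set_pmf (\<pi> js h)"
  shows "d \<in> allowed_decisions M (js (length h)) h"
  using assms unfolding clairvoyant_policy_def by blast

text \<open>Invariants of the reachable histories, by induction over rounds: an assignment is
  selected only while its offline type has been used fewer than \<open>capacity\<close> times, so
  one more success cannot exceed the capacity.\<close>

lemma clairvoyant_run:
  assumes \<pi>: "clairvoyant_policy M \<pi>" and "t \<le> horizon M" and "h \<in> set_pmf (run M \<pi> js t)"
  shows "length h = t" and "uses h i \<le> capacity M i"
    and "s < t \<Longrightarrow> fst (h ! s) \<in> insert None (Some ` assignments_on M (js s))"
proof -
  have "length h = t \<and> (\<forall>i. uses h i \<le> capacity M i) \<and>
    (\<forall>s<t. fst (h ! s) \<in> insert None (Some ` assignments_on M (js s)))"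
    using assms(2,3)
  proof (induction t arbitrary: h)
    case 0
    then show ?case by simp
  next
    case (Suc t)
    then obtain g d a where g: "g \<in> set_pmf (run M \<pi> js t)" "d \<in> set_pmf (\<pi> js g)"
      and h: "h = g @ [(d, a)]"
      by auto
    have IH: "length g = t" "\<forall>i. uses g i \<le> capacity M i"
      "\<forall>s<t. fst (g ! s) \<in> insert None (Some ` assignments_on M (js s))"
      using Suc.IH[OF Suc_leD[OF Suc.prems(1)] g(1)] by blast+
    have d: "d \<in> allowed_decisions M (js t) g"
      using clairvoyant_allowed[OF \<pi> _ g(2)] Suc.prems(1) IH(1) by simp
    then have "uses h i \<le> capacity M i" for i
      using IH(2) by (auto simp: h uses_snoc allowed_decisions_def Suc_le_eq)
    moreover have "fst (h ! s) \<in> insert None (Some ` assignments_on M (js s))" if "s < Suc t" for s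
      using IH d that by (auto simp: h nth_append allowed_decisions_def less_Suc_eq)
    ultimately show ?case
      using IH by (simp add: h)
  qed
  then show "length h = t" "uses h i \<le> capacity M i"
    "s < t \<Longrightarrow> fst (h ! s) \<in> insert None (Some ` assignments_on M (js s))"
    by auto
qed

lemma length_run: "h \<in> set_pmf (run M \<pi> js t) \<Longrightarrow> length h = t"
  by (induction t arbitrary: h) auto

lemma clairvoyant_outcome:
  assumes "clairvoyant_policy M \<pi>" and "h \<in> set_pmf (outcome M \<pi>)"
  shows "length h = horizon M" and "uses h i \<le> capacity M i"
    and "t < horizon M \<Longrightarrow> h ! t = (Some f, a) \<Longrightarrow> f \<in> assignments M"
proof -
  obtain js where "h \<in> set_pmf (run M \<pi> js (horizon M))"
    using assms by (auto simp: outcome_def)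
  note * = clairvoyant_run[OF assms(1) order_refl this]
  show "length h = horizon M" "uses h i \<le> capacity M i"
    by (rule *)+
  show "f \<in> assignments M" if "t < horizon M" "h ! t = (Some f, a)"
    using *(3)[OF that(1)] that(2) assignments_on_subset by force
qed

section \<open>Finiteness of the supports, which makes every real function of the history
  integrable\<close>

lemma finite_set_arrivals:
  assumes "mpkhd_instance M"
  shows "finite (set_pmf (arrivals M))"
proof (rule finite_subset)
  show "set_pmf (arrivals M) \<subseteq> PiE_dflt {..<horizon M} undefined (\<lambda>_. online M)"
    using assms by (force simp: arrivals_def set_Pi_pmf PiE_dflt_def mpkhd_instance_def)
  show "finite (PiE_dflt {..<horizon M} undefined (\<lambda>_. online M))"
    using assms by (intro finite_PiE_dflt) (auto simp: mpkhd_instance_def)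
qed

lemma finite_set_run:
  assumes M: "mpkhd_instance M" and \<pi>: "clairvoyant_policy M \<pi>" and "t \<le> horizon M"
  shows "finite (set_pmf (run M \<pi> js t))"
proof (rule finite_subset)
  let ?D = "insert None (Some ` assignments M) \<times> (UNIV :: bool set)"
  show "set_pmf (run M \<pi> js t) \<subseteq> {h. set h \<subseteq> ?D \<and> length h = t}"
  proof (intro subsetI CollectI conjI)
    fix h assume h: "h \<in> set_pmf (run M \<pi> js t)"
    note * = clairvoyant_run[OF \<pi> assms(3) h]
    show "length h = t" by (rule *)
    fix x assume "x \<in> set h"
    then obtain s where "s < t" "x = h ! s"
      using *(1) by (auto simp: in_set_conv_nth)
    then have "fst x \<in> insert None (Some ` assignments M)"
      using *(3)[of s] assignments_on_subset by fast
    then show "x \<in> ?D"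
      by (simp add: mem_Times_iff)
  qed
  show "finite {h. set h \<subseteq> ?D \<and> length h = t}"
    using finite_assignments[OF M] by (intro finite_lists_length_eq) auto
qed

lemma finite_set_outcome:
  assumes "mpkhd_instance M" and "clairvoyant_policy M \<pi>"
  shows "finite (set_pmf (outcome M \<pi>))"
  using finite_set_arrivals[OF assms(1)] finite_set_run[OF assms order_refl]
  by (simp add: outcome_def)

section \<open>Selection probabilities of a policy, the future LP variables\<close>

definition decision :: "('i, 'j) mpkhd \<Rightarrow> ('i, 'j) policy \<Rightarrow> nat \<Rightarrow> ('i, 'j) assignment option pmf"
  where "decision M \<pi> t = bind_pmf (arrivals M) (\<lambda>js. bind_pmf (run M \<pi> js t) (\<pi> js))"

text \<open>Entry \<open>t\<close> is written in round \<open>t\<close> and later rounds only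
  append, so its law is that of the decision followed by the acceptance draw.\<close>

lemma map_nth_run:
  assumes "t < n"
  shows "map_pmf (\<lambda>h. h ! t) (run M \<pi> js n) =
    bind_pmf (bind_pmf (run M \<pi> js t) (\<pi> js)) (\<lambda>d. map_pmf (Pair d) (acceptance M t d))"
  using assms
proof (induction n)
  case (Suc n)
  show ?case
  proof (cases "t = n")
    case True
    then show ?thesis
      by (auto simp: map_bind_pmf bind_assoc_pmf pmf.map_comp o_def nth_append dest: length_run
          intro!: bind_pmf_cong map_pmf_cong)
  next
    case False
    then have "map_pmf (\<lambda>h. h ! t) (run M \<pi> js (Suc n)) = map_pmf (\<lambda>h. h ! t) (run M \<pi> js n)"
      using Suc.prems
      by (auto simp: map_bind_pmf pmf.map_comp o_def nth_append length_run map_pmf_def[of _ "run M \<pi> js n"]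
          intro!: bind_pmf_cong)
    with False Suc show ?thesis by simp
  qed
qed simp

lemma map_nth_outcome:
  assumes "t < horizon M"
  shows "map_pmf (\<lambda>h. h ! t) (outcome M \<pi>) =
    bind_pmf (decision M \<pi> t) (\<lambda>d. map_pmf (Pair d) (acceptance M t d))"
  by (simp add: outcome_def decision_def map_bind_pmf map_nth_run[OF assms] bind_assoc_pmf)

text \<open>Given the decision, acceptance is drawn independently of the past, so the two
  probabilities multiply.\<close>

lemma prob_success:
  assumes M: "mpkhd_instance M" and f: "f \<in> assignments M" and t: "t < horizon M"
  shows "measure_pmf.prob (outcome M \<pi>) {h. h ! t = (Some f, True)} =
    pmf (decision M \<pi> t) (Some f) * accept_prob M f t"
proof -
  have p: "0 \<le> accept_prob M f t" "accept_prob M f t \<le> 1"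
    using M f t by (auto simp: mpkhd_instance_def intro: less_imp_le)
  have "measure_pmf.prob (outcome M \<pi>) {h. h ! t = (Some f, True)} =
    pmf (map_pmf (\<lambda>h. h ! t) (outcome M \<pi>)) (Some f, True)"
    by (simp add: pmf_map vimage_def)
  also have "\<dots> = (\<integral>d. pmf (map_pmf (Pair d) (acceptance M t d)) (Some f, True) \<partial>decision M \<pi> t)"
    by (simp add: map_nth_outcome[OF t] pmf_bind)
  also have "\<dots> = (\<integral>d. indicator {Some f} d * accept_prob M f t \<partial>decision M \<pi> t)"
  proof (intro Bochner_Integration.integral_cong refl)
    fix d
    show "pmf (map_pmf (Pair d) (acceptance M t d)) (Some f, True) =
      indicator {Some f} d * accept_prob M f t"
    proof (cases "d = Some f")
      case True
      then show ?thesis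
        using p pmf_map_inj'[of "Pair (Some f)" "acceptance M t d" True] by (simp add: inj_on_def)
    next
      case False
      then show ?thesis
        by (auto intro!: pmf_map_outside)
    qed
  qed
  finally show ?thesis
    by (simp add: measure_pmf_single)
qed

text \<open>Linearity of expectation over the success indicators. The profit of a policy becomes the
  LP objective evaluated at its selection probabilities.\<close>

lemma expected_profit_eq:
  assumes M: "mpkhd_instance M" and \<pi>: "clairvoyant_policy M \<pi>"
  shows "expected_profit M \<pi> = (\<Sum>t<horizon M. \<Sum>f\<in>assignments M.
    pmf (decision M \<pi> t) (Some f) * accept_prob M f t * profit M f t)"
proof -
  let ?O = "outcome M \<pi>"
  have int: "integrable (measure_pmf ?O) g" for g :: "_ \<Rightarrow> real"
    using finite_set_outcome[OF M \<pi>] by (rule integrable_measure_pmf_finite)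
  have "expected_profit M \<pi> = (\<integral>h. (\<Sum>t<horizon M. \<Sum>f\<in>assignments M.
    indicator {h. h ! t = (Some f, True)} h * profit M f t) \<partial>?O)"
    unfolding expected_profit_def
  proof (intro integral_cong_AE)
    show "AE h in ?O. total_profit M h = (\<Sum>t<horizon M. \<Sum>f\<in>assignments M.
      indicator {h. h ! t = (Some f, True)} h * profit M f t)"
    proof (rule AE_pmfI)
      fix h assume h: "h \<in> set_pmf ?O"
      have "(case h ! t of (Some f, True) \<Rightarrow> profit M f t | _ \<Rightarrow> 0) =
        (\<Sum>f\<in>assignments M. indicator {h. h ! t = (Some f, True)} h * profit M f t)"
        if t: "t < horizon M" for t
      proof (cases "h ! t")
        case (Pair d a)
        show ?thesis
        proof (cases "\<exists>f. d = Some f \<and> a")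
          case True
          then obtain f where f: "h ! t = (Some f, True)" using Pair by auto
          then have "f \<in> assignments M"
            using clairvoyant_outcome(3)[OF \<pi> h t] by blast
          then have "(\<Sum>g\<in>assignments M. indicator {h. h ! t = (Some g, True)} h * profit M g t)
            = (\<Sum>g\<in>{f}. profit M g t)"
            using f finite_assignments[OF M] by (intro sum.mono_neutral_cong_right) (auto simp: indicator_def)
          then show ?thesis using f by simp
        next
          case False
          then show ?thesis using Pair by (auto split: option.split bool.split simp: indicator_def)
        qed
      qed
      then show "total_profit M h = (\<Sum>t<horizon M. \<Sum>f\<in>assignments M.
        indicator {h. h ! t = (Some f, True)} h * profit M f t)"
        using clairvoyant_outcome(1)[OF \<pi> h] by (simp add: total_profit_def)
    qed
  qed auto
  also have "\<dots> = (\<Sum>t<horizon M. \<Sum>f\<in>assignments M.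
    measure_pmf.prob ?O {h. h ! t = (Some f, True)} * profit M f t)"
    by (simp add: int)
  also have "\<dots> = (\<Sum>t<horizon M. \<Sum>f\<in>assignments M.
    pmf (decision M \<pi> t) (Some f) * accept_prob M f t * profit M f t)"
    by (intro sum.cong refl) (simp add: prob_success[OF M])
  finally show ?thesis .
qed

text \<open>An assignment to \<open>j\<close> can be selected in round \<open>t\<close> only if
  \<open>j\<close> arrives in it, so the selection events lie inside the arrival event.\<close>

lemma decision_online_le:
  assumes M: "mpkhd_instance M" and \<pi>: "clairvoyant_policy M \<pi>" and t: "t < horizon M"
  shows "(\<Sum>f\<in>assignments_on M j. pmf (decision M \<pi> t) (Some f)) \<le> pmf (arrival M t) j"
proof -
  \<comment> \<open>The joint law of arrival sequence and decision: \<open>decision\<close> has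
    forgotten the arrivals, so the inclusion of events is formulated here and then
    projected.\<close>
  define \<Omega> where "\<Omega> = bind_pmf (arrivals M) (\<lambda>js. map_pmf (Pair js) (bind_pmf (run M \<pi> js t) (\<pi> js)))"
  have snd: "map_pmf snd \<Omega> = decision M \<pi> t"
    by (simp add: \<Omega>_def decision_def map_bind_pmf pmf.map_comp o_def)
  have fst: "map_pmf fst \<Omega> = arrivals M"
    by (simp add: \<Omega>_def map_bind_pmf pmf.map_comp o_def bind_return_pmf')
  have "map_pmf (\<lambda>(js, d). js t) \<Omega> = map_pmf (\<lambda>js. js t) (map_pmf fst \<Omega>)"
    by (simp add: pmf.map_comp o_def case_prod_unfold)
  also have "\<dots> = map_pmf (\<lambda>js. js t) (arrivals M)"
    by (simp only: fst)
  also have "\<dots> = arrival M t"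
    using t by (simp add: arrivals_def Pi_pmf_component)
  finally have js: "map_pmf (\<lambda>(js, d). js t) \<Omega> = arrival M t" .
  have "(\<Sum>f\<in>assignments_on M j. pmf (decision M \<pi> t) (Some f)) =
    measure_pmf.prob (decision M \<pi> t) (Some ` assignments_on M j)"
    using finite_assignments_on[OF M] by (simp add: measure_measure_pmf_finite sum.reindex)
  also have "\<dots> = measure_pmf.prob \<Omega> (snd -` Some ` assignments_on M j)"
    by (simp flip: snd)
  also have "\<dots> \<le> measure_pmf.prob \<Omega> {(js, d). js t = j}"
  proof (rule measure_pmf.finite_measure_mono_AE)
    show "AE x in \<Omega>. x \<in> snd -` Some ` assignments_on M j \<longrightarrow> x \<in> {(js, d). js t = j}"
    proof (rule AE_pmfI, safe)
      fix js d f assume "(js, d) \<in> set_pmf \<Omega>" and f: "f \<in> assignments_on M j" "snd (js, d) = Some f"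
      then obtain h where h: "h \<in> set_pmf (run M \<pi> js t)" "d \<in> set_pmf (\<pi> js h)"
        by (auto simp: \<Omega>_def)
      then have "d \<in> allowed_decisions M (js t) h"
        using clairvoyant_allowed[OF \<pi> _ h(2)] length_run[OF h(1)] t by simp
      then show "js t = j"
        using f by (auto simp: allowed_decisions_def assignments_on_def)
    qed
  qed simp
  also have "\<dots> = pmf (arrival M t) j"
    by (simp flip: js add: pmf_map vimage_def case_prod_unfold)
  finally show ?thesis .
qed

text \<open>The left-hand side is at most the expected number of uses of \<open>i\<close>, and no
  possible history exceeds the capacity.\<close>

lemma decision_offline_le:
  assumes M: "mpkhd_instance M" and \<pi>: "clairvoyant_policy M \<pi>"
  shows "(\<Sum>t<horizon M. \<Sum>f\<in>assignments_off M i.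
    pmf (decision M \<pi> t) (Some f) * accept_prob M f t) \<le> real (capacity M i)"
proof -
  let ?O = "outcome M \<pi>"
  have int: "integrable (measure_pmf ?O) g" for g :: "_ \<Rightarrow> real"
    using finite_set_outcome[OF M \<pi>] by (rule integrable_measure_pmf_finite)
  have "(\<Sum>t<horizon M. \<Sum>f\<in>assignments_off M i. pmf (decision M \<pi> t) (Some f) * accept_prob M f t)
    = (\<Sum>t<horizon M. \<Sum>f\<in>assignments_off M i. measure_pmf.prob ?O {h. h ! t = (Some f, True)})"
    by (intro sum.cong refl) (simp add: prob_success[OF M] subsetD[OF assignments_off_subset])
  also have "\<dots> = (\<integral>h. (\<Sum>t<horizon M. \<Sum>f\<in>assignments_off M i. indicator {h. h ! t = (Some f, True)} h) \<partial>?O)"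
    by (simp add: int)
  also have "\<dots> \<le> (\<integral>h. real (capacity M i) \<partial>?O)"
  proof (intro integral_mono_AE int AE_pmfI)
    fix h assume h: "h \<in> set_pmf ?O"
    \<comment> \<open>A round records a single decision, so at most one summand is nonzero.\<close>
    have "(\<Sum>f\<in>assignments_off M i. indicator {h. h ! t = (Some f, True)} h :: real)
      \<le> of_bool (\<exists>j k. h ! t = (Some (i, j, k), True))" if t: "t < horizon M" for t
    proof (cases "\<exists>f\<in>assignments_off M i. h ! t = (Some f, True)")
      case True
      then obtain f where f: "f \<in> assignments_off M i" "h ! t = (Some f, True)" by auto
      then have "(\<Sum>f\<in>assignments_off M i. indicator {h. h ! t = (Some f, True)} h :: real) = (\<Sum>f\<in>{f}. 1)"
        using finite_assignments_off[OF M] by (intro sum.mono_neutral_cong_right) (auto simp: indicator_def)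
      then show ?thesis
        using f by (auto simp: assignments_off_def)
    next
      case False
      then have "(\<Sum>f\<in>assignments_off M i. indicator {h. h ! t = (Some f, True)} h :: real) = 0"
        by (intro sum.neutral) (auto simp: indicator_def)
      then show ?thesis by simp
    qed
    then have "(\<Sum>t<horizon M. \<Sum>f\<in>assignments_off M i. indicator {h. h ! t = (Some f, True)} h)
      \<le> real (uses h i)"
      using clairvoyant_outcome(1)[OF \<pi> h] by (auto simp: real_uses simp del: sum_of_bool_eq intro!: sum_mono)
    also have "\<dots> \<le> real (capacity M i)"
      using clairvoyant_outcome(2)[OF \<pi> h] by simp
    finally show "(\<Sum>t<horizon M. \<Sum>f\<in>assignments_off M i. indicator {h. h ! t = (Some f, True)} h)
      \<le> real (capacity M i)" .
  qed
  finally show ?thesis by simp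
qed

section \<open>The LP bounds the clairvoyant optimum\<close>

lemma assignment_offline:
  assumes "mpkhd_instance M" and "f \<in> assignments M"
  shows "fst f \<in> offline M" and "fst (snd f) \<in> online M"
  using assms by (auto simp: mpkhd_instance_def assignments_def)

lemma mem_assignments_unit_split:
  "((i, n), j, k) \<in> assignments (unit_split M) \<longleftrightarrow> (i, j, k) \<in> assignments M \<and> n < capacity M i"
  by (auto simp: assignments_def unit_split_def)

lemma sum_unit_split:
  assumes "mpkhd_instance M"
  shows "(\<Sum>f\<in>assignments (unit_split M). g f) =
    (\<Sum>f\<in>assignments M. \<Sum>n<capacity M (fst f). g ((fst f, n), snd f))"
proof -
  have "(\<Sum>f\<in>assignments M. \<Sum>n<capacity M (fst f). g ((fst f, n), snd f)) =
    (\<Sum>(f, n)\<in>(SIGMA f:assignments M. {..<capacity M (fst f)}). g ((fst f, n), snd f))"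
    using finite_assignments[OF assms] by (subst sum.Sigma) auto
  also have "\<dots> = (\<Sum>f\<in>assignments (unit_split M). g f)"
    by (rule sum.reindex_bij_witness[of _ "\<lambda>((i, n), jk). ((i, jk), n)" "\<lambda>(f, n). ((fst f, n), snd f)"])
      (auto simp: mem_assignments_unit_split)
  finally show ?thesis by simp
qed

lemma sum_on_unit_split:
  assumes "mpkhd_instance M"
  shows "(\<Sum>f\<in>assignments_on (unit_split M) j. g f) =
    (\<Sum>f\<in>assignments_on M j. \<Sum>n<capacity M (fst f). g ((fst f, n), snd f))"
proof -
  have "(\<Sum>f\<in>assignments_on M j. \<Sum>n<capacity M (fst f). g ((fst f, n), snd f)) =
    (\<Sum>(f, n)\<in>(SIGMA f:assignments_on M j. {..<capacity M (fst f)}). g ((fst f, n), snd f))"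
    using finite_assignments_on[OF assms] by (subst sum.Sigma) auto
  also have "\<dots> = (\<Sum>f\<in>assignments_on (unit_split M) j. g f)"
    by (rule sum.reindex_bij_witness[of _ "\<lambda>((i, n), jk). ((i, jk), n)" "\<lambda>(f, n). ((fst f, n), snd f)"])
      (auto simp: mem_assignments_unit_split assignments_on_def)
  finally show ?thesis by simp
qed

lemma sum_off_unit_split:
  assumes "n < capacity M i"
  shows "(\<Sum>f\<in>assignments_off (unit_split M) (i, n). g f) =
    (\<Sum>f\<in>assignments_off M i. g ((i, n), snd f))"
  using assms
  by (intro sum.reindex_bij_witness[of _ "\<lambda>(i, jk). ((i, n), jk)" "\<lambda>((i, n), jk). (i, jk)"])
    (auto simp: mem_assignments_unit_split assignments_off_def)

lemma expected_profit_le_lp_value: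
  assumes M: "mpkhd_instance M" and \<pi>: "clairvoyant_policy M \<pi>" and x: "lp_optimal (unit_split M) x"
  shows "expected_profit M \<pi> \<le> lp_value (unit_split M) x"
proof -
  let ?U = "unit_split M"
  define y where "y = (\<lambda>f t. pmf (decision M \<pi> t) (Some f))"
  \<comment> \<open>Each selection probability is split evenly: summing over the copies restores
    \<open>y\<close>, while the offline load of at most \<open>capacity M i\<close> becomes at most
    1 per copy.\<close>
  define z where "z = (\<lambda>((i, n :: nat), jk) t. y (i, jk) t / capacity M i)"
  have cap: "capacity M (fst f) > 0" if "f \<in> assignments M" for f
    using M assignment_offline[OF M that] by (auto simp: mpkhd_instance_def)
  have U: "horizon ?U = horizon M" "arrival ?U = arrival M" "online ?U = online M"
    "accept_prob ?U ((i, n), jk) = accept_prob M (i, jk)"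
    "profit ?U ((i, n), jk) = profit M (i, jk)" for i n jk
    by (auto simp: unit_split_def split: prod.split)
  have "(\<Sum>f\<in>assignments_on ?U j. z f t) = (\<Sum>f\<in>assignments_on M j. y f t)" for j t
    unfolding sum_on_unit_split[OF M]
    using cap[OF subsetD[OF assignments_on_subset]] by (intro sum.cong refl) (force simp: z_def)
  moreover have "(\<Sum>t<horizon ?U. \<Sum>f\<in>assignments_off ?U i. z f t * accept_prob ?U f t) \<le> 1"
    if i: "i \<in> offline ?U" for i
  proof -
    obtain i' n where i': "i = (i', n)" "i' \<in> offline M" "n < capacity M i'"
      using i by (auto simp: unit_split_def)
    have "(\<Sum>t<horizon ?U. \<Sum>f\<in>assignments_off ?U i. z f t * accept_prob ?U f t) =
      (\<Sum>t<horizon M. \<Sum>f\<in>assignments_off M i'. y f t * accept_prob M f t / capacity M i')"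
      unfolding i' sum_off_unit_split[OF i'(3)] U
      by (intro sum.cong refl) (auto simp: z_def assignments_off_def)
    also have "\<dots> = (\<Sum>t<horizon M. \<Sum>f\<in>assignments_off M i'. y f t * accept_prob M f t) / capacity M i'"
      by (simp add: sum_divide_distrib)
    also have "\<dots> \<le> 1"
      using decision_offline_le[OF M \<pi>, of i'] i'(3) by (simp add: y_def)
    finally show ?thesis .
  qed
  moreover have "0 \<le> z f t" for f t
    by (auto simp: z_def y_def split: prod.split)
  ultimately have "lp_feasible ?U z"
    using decision_online_le[OF M \<pi>] by (simp add: lp_feasible_def U y_def)
  moreover have "lp_value ?U z = (\<Sum>t<horizon M. \<Sum>f\<in>assignments M. y f t * accept_prob M f t * profit M f t)"
    unfolding lp_value_def sum_unit_split[OF M] U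
    using cap by (intro sum.cong refl) (auto simp: z_def)
  then have "lp_value ?U z = expected_profit M \<pi>"
    by (simp add: expected_profit_eq[OF M \<pi>] y_def)
  ultimately show ?thesis
    using x by (auto simp: lp_optimal_def)
qed

text \<open>A real supremum dominates its members only if the set is bounded above; the LP value
  provides the bound.\<close>

lemma expected_profit_le_opt_off:
  assumes M: "mpkhd_instance M" and \<pi>: "clairvoyant_policy M \<pi>"
  shows "expected_profit M \<pi> \<le> opt_off M"
proof -
  obtain x where x: "lp_optimal (unit_split M) x"
    using lp_optimal_exists[OF M] by blast
  show ?thesis
    unfolding opt_off_def
    using expected_profit_le_lp_value[OF M _ x] \<pi> by (intro cSUP_upper bdd_aboveI2) auto
qed

lemma opt_off_le_lp_value:
  assumes M: "mpkhd_instance M" and x: "lp_optimal (unit_split M) x"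
  shows "opt_off M \<le> lp_value (unit_split M) x"
proof -
  \<comment> \<open>Always rejecting is allowed, so the supremum ranges over a nonempty set.\<close>
  have "clairvoyant_policy M (\<lambda>_ _. return_pmf None)"
    by (auto simp: clairvoyant_policy_def allowed_decisions_def)
  then show ?thesis
    unfolding opt_off_def
    using expected_profit_le_lp_value[OF M _ x] by (intro cSUP_least) auto
qed

section \<open>The process of SAMP on a unit-capacity instance\<close>

lemma measure_bind_pmf:
  "measure_pmf.prob (bind_pmf p f) A = (\<integral>x. measure_pmf.prob (f x) A \<partial>measure_pmf p)"
proof -
  have *: "measure_pmf.prob q A = pmf (map_pmf (\<lambda>x. x \<in> A) q) True" for q
    by (simp add: pmf_map vimage_def)
  show ?thesis
    unfolding * by (simp add: map_bind_pmf pmf_bind)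
qed

lemma run_cong_arrivals:
  assumes "\<And>h. length h < t \<Longrightarrow> \<pi> js h = \<pi> js' h"
  shows "run M \<pi> js t = run M \<pi> js' t"
  using assms
proof (induction t)
  case (Suc t)
  then have "run M \<pi> js t = run M \<pi> js' t" by simp
  then show ?case
    using Suc.prems by (auto intro!: bind_pmf_cong dest: length_run)
qed simp

text \<open>For a policy that reads only the current arrival, the history before round
  \<open>t\<close> is independent of the arrival in round \<open>t\<close>. Although
  \<open>arrivals\<close> draws the whole sequence in advance, the type of round \<open>t\<close>
  can therefore be drawn after the history.\<close>

lemma bind_arrivals_run:
  assumes \<pi>: "\<And>js js' h. js (length h) = js' (length h) \<Longrightarrow> \<pi> js h = \<pi> js' h"
    and t: "t < horizon M"
  shows "bind_pmf (arrivals M) (\<lambda>js. bind_pmf (run M \<pi> js t) (G (js t))) =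
    bind_pmf (bind_pmf (arrivals M) (\<lambda>js. run M \<pi> js t)) (\<lambda>h. bind_pmf (arrival M t) (\<lambda>j. G j h))"
proof -
  let ?P = "Pi_pmf ({..<horizon M} - {t}) undefined (arrival M)"
  have "{..<horizon M} = insert t ({..<horizon M} - {t})"
    using t by auto
  then have "arrivals M = Pi_pmf (insert t ({..<horizon M} - {t})) undefined (arrival M)"
    by (simp add: arrivals_def)
  also have "\<dots> = bind_pmf (arrival M t) (\<lambda>j. map_pmf (\<lambda>js. js(t := j)) ?P)"
    by (subst Pi_pmf_insert') (auto simp: map_pmf_def)
  finally have arr: "arrivals M = bind_pmf (arrival M t) (\<lambda>j. map_pmf (\<lambda>js. js(t := j)) ?P)" .
  \<comment> \<open>The first \<open>t\<close> rounds read only the coordinates below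
    \<open>t\<close>.\<close>
  have upd: "run M \<pi> (js(t := j)) t = run M \<pi> js t" for js j
    by (intro run_cong_arrivals \<pi>) auto
  have "bind_pmf (arrivals M) (\<lambda>js. run M \<pi> js t) = bind_pmf ?P (\<lambda>js. run M \<pi> js t)"
    by (simp add: arr bind_assoc_pmf bind_map_pmf upd)
  moreover have "bind_pmf (arrivals M) (\<lambda>js. bind_pmf (run M \<pi> js t) (G (js t))) =
    bind_pmf (arrival M t) (\<lambda>j. bind_pmf (bind_pmf ?P (\<lambda>js. run M \<pi> js t)) (G j))"
    by (simp add: arr bind_assoc_pmf bind_map_pmf upd)
  ultimately show ?thesis
    by (simp add: bind_commute_pmf[of "arrival M t"])
qed

text \<open>The Weierstrass product inequality; the induction multiplies by the nonnegative factor
  \<open>1 - r t\<close> and drops a nonnegative cross term.\<close>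

lemma prod_ge_1_minus_sum:
  fixes r :: "nat \<Rightarrow> real"
  assumes "\<And>s. s < t \<Longrightarrow> 0 \<le> r s" and "\<And>s. s < t \<Longrightarrow> r s \<le> 1"
  shows "1 - (\<Sum>s<t. r s) \<le> (\<Prod>s<t. 1 - r s)"
  using assms
proof (induction t)
  case (Suc t)
  have "0 \<le> r t" "0 \<le> 1 - r t" "0 \<le> (\<Sum>s<t. r s)"
    using Suc.prems by (auto intro!: sum_nonneg)
  then have "1 - (\<Sum>s<Suc t. r s) \<le> (1 - (\<Sum>s<t. r s)) * (1 - r t)"
    by (simp add: algebra_simps)
  also have "\<dots> \<le> (\<Prod>s<t. 1 - r s) * (1 - r t)"
    using Suc \<open>0 \<le> 1 - r t\<close> by (intro mult_right_mono) auto
  finally show ?case by simp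
qed simp

lemma expectation_of_bool:
  "measure_pmf.expectation p (\<lambda>h. of_bool (P h)) = measure_pmf.prob p {h. P h}"
proof -
  have "(\<lambda>h. of_bool (P h) :: real) = indicator {h. P h}"
    by (auto simp: fun_eq_iff indicator_def)
  then show ?thesis by simp
qed

lemma variance_sum_of_bool:
  fixes P :: "'i \<Rightarrow> 'a \<Rightarrow> bool"
  assumes fin: "finite (set_pmf p)" and I: "finite I"
    and X: "\<And>h. h \<in> set_pmf p \<Longrightarrow> X h = (\<Sum>i\<in>I. 1 - of_bool (P i h))"
  shows "measure_pmf.variance p X = (\<Sum>i\<in>I. \<Sum>k\<in>I.
    measure_pmf.prob p {h. P i h \<and> P k h} -
    measure_pmf.prob p {h. P i h} * measure_pmf.prob p {h. P k h})"
proof -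
  define q where "q = (\<lambda>i. measure_pmf.prob p {h. P i h})"
  have int: "integrable (measure_pmf p) g" for g :: "_ \<Rightarrow> real"
    using fin by (rule integrable_measure_pmf_finite)
  have q: "measure_pmf.expectation p (\<lambda>h. of_bool (P i h)) = q i" for i
    by (simp add: q_def expectation_of_bool)
  have q2: "measure_pmf.expectation p (\<lambda>h. of_bool (P i h) * of_bool (P k h)) =
    measure_pmf.prob p {h. P i h \<and> P k h}" for i k
    by (simp add: expectation_of_bool flip: of_bool_conj)
  have "measure_pmf.expectation p X = (\<integral>h. (\<Sum>i\<in>I. 1 - of_bool (P i h)) \<partial>p)"
    using X by (intro integral_cong_AE AE_pmfI) auto
  also have "\<dots> = (\<Sum>i\<in>I. 1 - q i)"
    by (simp add: int q del: sum_of_bool_eq sum_subtractf)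
  finally have E: "measure_pmf.expectation p X = (\<Sum>i\<in>I. 1 - q i)" .
  have "measure_pmf.variance p X =
    (\<integral>h. (\<Sum>i\<in>I. \<Sum>k\<in>I. of_bool (P i h) * of_bool (P k h) - q i * of_bool (P k h)
      - of_bool (P i h) * q k + q i * q k) \<partial>p)"
  proof (intro integral_cong_AE AE_pmfI)
    fix h assume "h \<in> set_pmf p"
    then have "X h - measure_pmf.expectation p X = - (\<Sum>i\<in>I. of_bool (P i h) - q i)"
      by (simp add: X E sum_subtractf del: sum_of_bool_eq)
    then have "(X h - measure_pmf.expectation p X)\<^sup>2 =
      (\<Sum>i\<in>I. \<Sum>k\<in>I. (of_bool (P i h) - q i) * (of_bool (P k h) - q k))"
      by (simp add: power2_eq_square sum_product del: sum_of_bool_eq sum_subtractf)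
    also have "\<dots> = (\<Sum>i\<in>I. \<Sum>k\<in>I. of_bool (P i h) * of_bool (P k h) - q i * of_bool (P k h)
      - of_bool (P i h) * q k + q i * q k)"
      by (intro sum.cong refl) (simp add: algebra_simps)
    finally show "(X h - measure_pmf.expectation p X)\<^sup>2 = \<dots>" .
  qed auto
  also have "\<dots> = (\<Sum>i\<in>I. \<Sum>k\<in>I. measure_pmf.prob p {h. P i h \<and> P k h} - q i * q k)"
    by (simp add: int q q2 del: sum_of_bool_eq sum_subtractf)
  finally show ?thesis
    by (simp add: q_def)
qed


section \<open>SAMP with a feasible LP solution on a unit-capacity instance\<close>

locale unit_samp =
  fixes \<gamma> :: real and U :: "('i, 'j) mpkhd" and x :: "('i, 'j) assignment \<Rightarrow> nat \<Rightarrow> real"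
  assumes \<gamma>: "0 \<le> \<gamma>" "\<gamma> \<le> 1"
    and U: "mpkhd_instance U"
    and unit_capacity: "\<And>i. capacity U i = 1"
    and feasible: "lp_feasible U x"
begin

abbreviation \<pi> :: "('i, 'j) policy" where
  "\<pi> \<equiv> samp_policy \<gamma> U x"

lemma x_nonneg: "f \<in> assignments U \<Longrightarrow> t < horizon U \<Longrightarrow> 0 \<le> x f t"
  using feasible by (simp add: lp_feasible_def)

lemma accept_prob_bounds:
  "f \<in> assignments U \<Longrightarrow> t < horizon U \<Longrightarrow> 0 \<le> accept_prob U f t"
  "f \<in> assignments U \<Longrightarrow> t < horizon U \<Longrightarrow> accept_prob U f t \<le> 1"
  using U by (auto simp: mpkhd_instance_def intro: less_imp_le)

text \<open>Extends the online constraint to types outside \<open>online U\<close>, which have no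
  assignments.\<close>

lemma x_online_le:
  assumes "t < horizon U"
  shows "(\<Sum>f\<in>assignments_on U j. x f t) \<le> pmf (arrival U t) j"
proof (cases "j \<in> online U")
  case True
  then show ?thesis using feasible assms by (simp add: lp_feasible_def)
next
  case False
  then have "assignments_on U j = {}"
    using assignment_offline(2)[OF U] by (force simp: assignments_on_def)
  then show ?thesis by simp
qed

lemma x_le_arrival:
  assumes "f \<in> assignments U" and "t < horizon U"
  shows "x f t \<le> pmf (arrival U t) (fst (snd f))"
proof -
  have "x f t \<le> (\<Sum>f\<in>assignments_on U (fst (snd f)). x f t)"
    using assms x_nonneg finite_assignments_on[OF U] assignments_on_subset
    by (intro member_le_sum) (auto simp: assignments_on_def)
  then show ?thesis
    using x_online_le[OF assms(2)] by (rule order_trans)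
qed

text \<open>\<open>embed_pmf\<close> is meaningful only for nonnegative weights of total 1. The
  online constraint and \<gamma> \<le> 1 make the rejection weight nonnegative. For a type of
  arrival probability 0 the quotients are 0 by convention, so it is surely rejected.\<close>

lemma pmf_sample_assignment:
  assumes t: "t < horizon U"
  shows "pmf (sample_assignment \<gamma> U x j t) s = (case s of
       None \<Rightarrow> 1 - (\<Sum>f\<in>assignments_on U j. \<gamma> * x f t / pmf (arrival U t) j)
     | Some f \<Rightarrow> if f \<in> assignments_on U j then \<gamma> * x f t / pmf (arrival U t) j else 0)"
    (is "_ = ?w s")
proof -
  let ?F = "assignments_on U j" and ?q = "pmf (arrival U t) j"
  let ?S = "\<Sum>f\<in>?F. \<gamma> * x f t / ?q"
  have nonneg: "0 \<le> \<gamma> * x f t / ?q" if "f \<in> ?F" for f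
    using \<gamma> x_nonneg[OF subsetD[OF assignments_on_subset that] t] by simp
  have "?S = \<gamma> * ((\<Sum>f\<in>?F. x f t) / ?q)"
    by (simp add: sum_distrib_left sum_divide_distrib)
  also have "\<dots> \<le> 1 * 1"
    using \<gamma> x_online_le[OF t] x_nonneg[OF subsetD[OF assignments_on_subset] t]
    by (intro mult_mono divide_nonneg_nonneg sum_nonneg) (auto simp: divide_le_eq_1 less_le)
  finally have S: "?S \<le> 1" by simp
  have fin: "finite ?F"
    by (rule finite_assignments_on[OF U])
  have "(\<integral>\<^sup>+s. ennreal (?w s) \<partial>count_space UNIV) = (\<Sum>s\<in>insert None (Some ` ?F). ennreal (?w s))"
    using fin by (intro nn_integral_count_space') (auto split: option.splits)
  also have "\<dots> = ennreal (1 - ?S) + (\<Sum>f\<in>?F. ennreal (\<gamma> * x f t / ?q))"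
    using fin by (simp add: sum.reindex)
  also have "\<dots> = ennreal (1 - ?S) + ennreal ?S"
    using nonneg by (simp add: sum_ennreal)
  also have "\<dots> = 1"
    using S nonneg by (simp add: sum_nonneg flip: ennreal_plus)
  finally show ?thesis
    unfolding sample_assignment_def
    using S nonneg by (intro pmf_embed_pmf) (auto split: option.splits)
qed

lemma set_sample_assignment:
  assumes "t < horizon U" and "s \<in> set_pmf (sample_assignment \<gamma> U x j t)"
  shows "s \<in> insert None (Some ` assignments_on U j)"
  using assms by (auto simp: set_pmf_iff pmf_sample_assignment split: option.splits if_splits)

text \<open>The capacity check of SAMP for unit capacities, separated from the sample so that the
  sample can be averaged over the arriving type.\<close>

definition available :: "('i, 'j) history \<Rightarrow> ('i, 'j) assignment option \<Rightarrow> ('i, 'j) assignment option" where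
  "available h s = (case s of None \<Rightarrow> None | Some f \<Rightarrow> if uses h (fst f) = 0 then Some f else None)"

lemma samp_policy_eq:
  "\<pi> js h = map_pmf (available h) (sample_assignment \<gamma> U x (js (length h)) (length h))"
  by (simp add: samp_policy_def available_def[abs_def] unit_capacity)

text \<open>Makes the general results on selection probabilities and histories applicable to
  SAMP.\<close>

lemma clairvoyant_samp: "clairvoyant_policy U \<pi>"
  unfolding clairvoyant_policy_def
proof (intro allI impI subsetI)
  fix js h d assume t: "length h < horizon U" and "d \<in> set_pmf (\<pi> js h)"
  then obtain s where s: "s \<in> set_pmf (sample_assignment \<gamma> U x (js (length h)) (length h))"
    "d = available h s"
    by (auto simp: samp_policy_eq)
  then show "d \<in> allowed_decisions U (js (length h)) h"
    using set_sample_assignment[OF t s(1)]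
    by (auto simp: available_def allowed_decisions_def unit_capacity split: if_splits)
qed

definition pooled_sample :: "nat \<Rightarrow> ('i, 'j) assignment option pmf" where
  "pooled_sample t = bind_pmf (arrival U t) (\<lambda>j. sample_assignment \<gamma> U x j t)"

text \<open>Averaging over arrivals cancels the division by the arrival probability. If that
  probability is 0, then \<open>x f t\<close> is 0 as well, being squeezed between 0 and it.\<close>

lemma pmf_pooled_sample:
  assumes f: "f \<in> assignments U" and t: "t < horizon U"
  shows "pmf (pooled_sample t) (Some f) = \<gamma> * x f t"
proof -
  define j where "j = fst (snd f)"
  have on: "f \<in> assignments_on U j' \<longleftrightarrow> j' = j" for j'
    using f by (auto simp: assignments_on_def j_def)
  have "pmf (pooled_sample t) (Some f) =
    (\<integral>j'. (if j' = j then \<gamma> * x f t / pmf (arrival U t) j' else 0) \<partial>arrival U t)"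
    by (simp add: pooled_sample_def pmf_bind pmf_sample_assignment[OF t] on)
  also have "\<dots> = pmf (arrival U t) j * (\<gamma> * x f t / pmf (arrival U t) j)"
    by (subst integral_measure_pmf[of "{j}"]) (auto split: if_splits)
  also have "\<dots> = \<gamma> * x f t"
    using x_le_arrival[OF f t] x_nonneg[OF f t] by (auto simp: j_def)
  finally show ?thesis .
qed

lemma set_pooled_sample:
  assumes "t < horizon U" and "s \<in> set_pmf (pooled_sample t)"
  shows "s \<in> insert None (Some ` assignments U)"
  using assms set_sample_assignment[OF assms(1)] assignments_on_subset
  by (fastforce simp: pooled_sample_def)

section \<open>The history of SAMP as a Markov chain driven by independent samples\<close>

definition state :: "nat \<Rightarrow> ('i, 'j) history pmf" where
  "state t = bind_pmf (arrivals U) (\<lambda>js. run U \<pi> js t)"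

lemma state_horizon: "state (horizon U) = outcome U \<pi>"
  by (simp add: state_def outcome_def)

text \<open>\<open>G\<close> stands for whatever follows the decision: returning it gives the law of
  the decision, appending it with its acceptance gives the next state.\<close>

lemma bind_state:
  assumes t: "t < horizon U"
  shows "bind_pmf (arrivals U) (\<lambda>js. bind_pmf (run U \<pi> js t) (\<lambda>h. bind_pmf (\<pi> js h) (G h))) =
    bind_pmf (state t) (\<lambda>h. bind_pmf (map_pmf (available h) (pooled_sample t)) (G h))"
proof -
  have "bind_pmf (arrivals U) (\<lambda>js. bind_pmf (run U \<pi> js t) (\<lambda>h. bind_pmf (\<pi> js h) (G h))) =
    bind_pmf (arrivals U) (\<lambda>js. bind_pmf (run U \<pi> js t)
      (\<lambda>h. bind_pmf (map_pmf (available h) (sample_assignment \<gamma> U x (js t) t)) (G h)))"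
    by (auto intro!: bind_pmf_cong simp: samp_policy_eq dest: length_run)
  also have "\<dots> = bind_pmf (state t) (\<lambda>h. bind_pmf (arrival U t) (\<lambda>j.
      bind_pmf (map_pmf (available h) (sample_assignment \<gamma> U x j t)) (G h)))"
    unfolding state_def
    using bind_arrivals_run[where \<pi> = \<pi> and M = U and t = t and
        G = "\<lambda>j h. bind_pmf (map_pmf (available h) (sample_assignment \<gamma> U x j t)) (G h)"] t
    by (simp add: samp_policy_eq)
  finally show ?thesis
    by (simp add: pooled_sample_def map_bind_pmf bind_assoc_pmf)
qed

lemma decision_samp:
  assumes "t < horizon U"
  shows "decision U \<pi> t = bind_pmf (state t) (\<lambda>h. map_pmf (available h) (pooled_sample t))"
  using bind_state[OF assms, of "\<lambda>_. return_pmf"] by (simp add: decision_def bind_return_pmf')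

lemma state_Suc:
  assumes "t < horizon U"
  shows "state (Suc t) = bind_pmf (state t) (\<lambda>h. bind_pmf (pooled_sample t) (\<lambda>s.
    map_pmf (\<lambda>a. h @ [(available h s, a)]) (acceptance U t (available h s))))"
  using bind_state[OF assms, of "\<lambda>h d. map_pmf (\<lambda>a. h @ [(d, a)]) (acceptance U t d)"]
  by (simp add: state_def bind_map_pmf)

text \<open>For rounds below the horizon, the probability that the pooled sample targets
  \<open>C\<close> and its acceptance draw succeeds, regardless of availability.\<close>

definition rate :: "'i set \<Rightarrow> nat \<Rightarrow> real" where
  "rate C t = (\<Sum>f\<in>{f \<in> assignments U. fst f \<in> C}. \<gamma> * x f t * accept_prob U f t)"

definition prob_unused :: "'i set \<Rightarrow> nat \<Rightarrow> real" where
  "prob_unused C t = measure_pmf.prob (state t) {h. \<forall>i\<in>C. uses h i = 0}"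

text \<open>While the types in \<open>C\<close> are unused, the availability filter does not affect samples
  targeting \<open>C\<close>, and samples targeting other types do not matter: the chance of an
  attempt on \<open>C\<close> does not depend on the history.\<close>

lemma prob_unused_Suc:
  assumes t: "t < horizon U"
  shows "prob_unused C (Suc t) = prob_unused C t * (1 - rate C t)"
proof -
  let ?A = "{h. \<forall>i\<in>C. uses h i = 0}"
  let ?step = "\<lambda>h s. map_pmf (\<lambda>a. h @ [(available h s, a)]) (acceptance U t (available h s))"
  define w where "w s = (case s of None \<Rightarrow> 0 | Some f \<Rightarrow> if fst f \<in> C then accept_prob U f t else 0)" for s
  have fin: "finite (insert None (Some ` assignments U))"
    using finite_assignments[OF U] by simp
  have step: "measure_pmf.prob (bind_pmf (pooled_sample t) (?step h)) ?A = of_bool (h \<in> ?A) * (1 - rate C t)" for h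
  proof (cases "h \<in> ?A")
    case True
    have "measure_pmf.prob (?step h s) ?A = 1 - w s" if s: "s \<in> set_pmf (pooled_sample t)" for s
    proof (cases "\<exists>f. s = Some f \<and> fst f \<in> C")
      case True
      then obtain f where f: "s = Some f" "fst f \<in> C" by auto
      have "f \<in> assignments U"
        using set_pooled_sample[OF t s] f by auto
      note p = accept_prob_bounds[OF this t]
      have "available h s = Some f"
        using \<open>h \<in> ?A\<close> f by (auto simp: available_def)
      moreover have "(\<lambda>a. h @ [(Some f, a)]) -` ?A = {False}"
        using \<open>h \<in> ?A\<close> f by (cases f) (auto simp: uses_snoc)
      ultimately show ?thesis
        using p f by (simp add: w_def measure_pmf_single)
    next
      case False
      then have "(\<lambda>a. h @ [(available h s, a)]) -` ?A = UNIV"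
        using \<open>h \<in> ?A\<close> by (auto simp: uses_snoc available_def split: option.splits if_splits)
      then show ?thesis
        using False by (auto simp: w_def split: option.splits)
    qed
    then have "measure_pmf.prob (bind_pmf (pooled_sample t) (?step h)) ?A =
      (\<integral>s. 1 - w s \<partial>pooled_sample t)"
      unfolding measure_bind_pmf by (intro integral_cong_AE AE_pmfI) auto
    also have "\<dots> = 1 - (\<integral>s. w s \<partial>pooled_sample t)"
      using set_pooled_sample[OF t] finite_subset[OF _ fin]
      by (subst Bochner_Integration.integral_diff) (auto intro!: integrable_measure_pmf_finite)
    also have "(\<integral>s. w s \<partial>pooled_sample t) = (\<Sum>s\<in>Some ` assignments U. pmf (pooled_sample t) s * w s)"
      using finite_assignments[OF U]
      by (subst integral_measure_pmf[of "Some ` assignments U"])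
        (auto simp: w_def split: option.splits dest: set_pooled_sample[OF t])
    also have "\<dots> = (\<Sum>f\<in>assignments U. if fst f \<in> C then \<gamma> * x f t * accept_prob U f t else 0)"
      by (simp add: sum.reindex w_def pmf_pooled_sample[OF _ t] if_distrib cong: if_cong sum.cong)
    also have "\<dots> = rate C t"
      using finite_assignments[OF U] by (simp add: rate_def sum.inter_filter)
    finally show ?thesis using True by simp
  next
    case False
    \<comment> \<open>A used type stays used.\<close>
    then have "(\<lambda>a. h @ [(available h s, a)]) -` ?A = {}" for s
      by (auto simp: uses_snoc)
    then have "measure_pmf.prob (?step h s) ?A = 0" for s
      by (simp only: measure_map_pmf measure_empty)
    then show ?thesis
      using False by (simp only: measure_bind_pmf) simp
  qed
  have "prob_unused C (Suc t) = (\<integral>h. of_bool (h \<in> ?A) * (1 - rate C t) \<partial>state t)"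
    unfolding prob_unused_def state_Suc[OF t] measure_bind_pmf[of "state t"] step ..
  also have "\<dots> = prob_unused C t * (1 - rate C t)"
    by (simp add: expectation_of_bool prob_unused_def)
  finally show ?thesis .
qed

lemma prob_unused_eq:
  "t \<le> horizon U \<Longrightarrow> prob_unused C t = (\<Prod>s<t. 1 - rate C s)"
proof (induction t)
  case 0
  then show ?case by (simp add: prob_unused_def state_def)
next
  case (Suc t)
  then show ?case by (simp add: prob_unused_Suc)
qed

lemma rate_nonneg: "t < horizon U \<Longrightarrow> 0 \<le> rate C t"
  unfolding rate_def using \<gamma> x_nonneg accept_prob_bounds by (intro sum_nonneg mult_nonneg_nonneg) auto

text \<open>Without the acceptance probabilities the sum is the probability that the pooled sample
  targets \<open>C\<close>.\<close>

lemma rate_le_1: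
  assumes t: "t < horizon U"
  shows "rate C t \<le> 1"
proof -
  have "rate C t \<le> (\<Sum>f\<in>{f \<in> assignments U. fst f \<in> C}. \<gamma> * x f t)"
    unfolding rate_def
    using \<gamma> x_nonneg accept_prob_bounds t by (intro sum_mono mult_left_le mult_nonneg_nonneg) auto
  also have "\<dots> = measure_pmf.prob (pooled_sample t) (Some ` {f \<in> assignments U. fst f \<in> C})"
    using finite_assignments[OF U] t
    by (auto simp: measure_measure_pmf_finite sum.reindex pmf_pooled_sample intro!: sum.cong)
  also have "\<dots> \<le> 1" by simp
  finally show ?thesis .
qed

lemma rate_Un:
  assumes "C \<inter> D = {}"
  shows "rate (C \<union> D) t = rate C t + rate D t"
proof -
  have "{f \<in> assignments U. fst f \<in> C \<union> D} =
    {f \<in> assignments U. fst f \<in> C} \<union> {f \<in> assignments U. fst f \<in> D}" by auto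
  then show ?thesis
    using finite_assignments[OF U] assms unfolding rate_def
    by (simp add: sum.union_disjoint disjoint_iff)
qed

text \<open>The offline constraint of the LP scaled by \<gamma>.\<close>

lemma sum_rate_le:
  assumes "i \<in> offline U"
  shows "(\<Sum>t<horizon U. rate {i} t) \<le> \<gamma>"
proof -
  have "{f \<in> assignments U. fst f \<in> {i}} = assignments_off U i"
    by (auto simp: assignments_off_def)
  then have "(\<Sum>t<horizon U. rate {i} t) =
    \<gamma> * (\<Sum>t<horizon U. \<Sum>f\<in>assignments_off U i. x f t * accept_prob U f t)"
    by (simp add: rate_def sum_distrib_left mult.assoc)
  also have "\<dots> \<le> \<gamma>"
    using \<gamma> feasible assms by (intro mult_left_le) (auto simp: lp_feasible_def)
  finally show ?thesis .
qed

lemma prob_unused_ge: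
  assumes i: "i \<in> offline U" and t: "t \<le> horizon U"
  shows "1 - \<gamma> \<le> prob_unused {i} t"
proof -
  have "(\<Sum>s<t. rate {i} s) \<le> (\<Sum>s<horizon U. rate {i} s)"
    using t rate_nonneg by (intro sum_mono2) auto
  then have "1 - \<gamma> \<le> 1 - (\<Sum>s<t. rate {i} s)"
    using sum_rate_le[OF i] by simp
  also have "\<dots> \<le> (\<Prod>s<t. 1 - rate {i} s)"
    using t rate_nonneg rate_le_1 by (intro prod_ge_1_minus_sum) auto
  finally show ?thesis
    by (simp add: prob_unused_eq[OF t])
qed

lemma expected_profit_samp:
  "expected_profit U \<pi> = (\<Sum>t<horizon U. \<Sum>f\<in>assignments U.
    \<gamma> * prob_unused {fst f} t * (x f t * accept_prob U f t * profit U f t))"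
proof -
  have "pmf (decision U \<pi> t) (Some f) = prob_unused {fst f} t * (\<gamma> * x f t)"
    if t: "t < horizon U" and f: "f \<in> assignments U" for t f
  proof -
    have "pmf (map_pmf (available h) (pooled_sample t)) (Some f) = of_bool (uses h (fst f) = 0) * (\<gamma> * x f t)" for h
    proof -
      have "available h -` {Some f} = (if uses h (fst f) = 0 then {Some f} else {})"
        by (auto simp: available_def split: option.splits if_splits)
      then show ?thesis
        by (simp add: pmf_map measure_pmf_single pmf_pooled_sample[OF f t])
    qed
    then show ?thesis
      by (simp add: decision_samp[OF t] pmf_bind expectation_of_bool prob_unused_def)
  qed
  then show ?thesis
    by (auto simp: expected_profit_eq[OF U clairvoyant_samp] intro!: sum.cong)
qed

text \<open>Term by term: every LP term is nonnegative and is retained with a factor of at least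
  \<open>\<gamma> * (1 - \<gamma>)\<close>.\<close>

lemma expected_profit_samp_ge: "\<gamma> * (1 - \<gamma>) * lp_value U x \<le> expected_profit U \<pi>"
proof -
  have "0 \<le> x f t * accept_prob U f t * profit U f t" if "f \<in> assignments U" "t < horizon U" for f t
    using that U x_nonneg accept_prob_bounds by (auto simp: mpkhd_instance_def)
  then show ?thesis
    unfolding expected_profit_samp lp_value_def sum_distrib_left
    using \<gamma> prob_unused_ge assignment_offline(1)[OF U]
    by (intro sum_mono mult_right_mono mult_left_mono) auto
qed

text \<open>Under unit capacities the number of successes is the number of offline types that get
  used, so it is a sum of indicators. The terms with \<open>i = k\<close> are their
  variances.\<close>

lemma variance_samp:
  "variance_successes U \<pi> = (\<Sum>i\<in>offline U. \<Sum>k\<in>offline U.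
    prob_unused {i, k} (horizon U) - prob_unused {i} (horizon U) * prob_unused {k} (horizon U))"
proof -
  have "real (successes h) = (\<Sum>i\<in>offline U. 1 - of_bool (uses h i = 0))"
    if h: "h \<in> set_pmf (outcome U \<pi>)" for h
  proof -
    note * = clairvoyant_outcome[OF clairvoyant_samp h]
    \<comment> \<open>A success belongs to exactly one offline type.\<close>
    have "of_bool (\<exists>f. h ! s = (Some f, True)) =
      (\<Sum>i\<in>offline U. of_bool (\<exists>j k. h ! s = (Some (i, j, k), True)) :: real)"
      if s: "s < horizon U" for s
    proof (cases "\<exists>f. h ! s = (Some f, True)")
      case True
      then obtain i j k where f: "h ! s = (Some (i, j, k), True)" by auto
      then have "i \<in> offline U"
        using *(3)[OF s f] assignment_offline(1)[OF U] by fastforce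
      then have "(\<Sum>i\<in>offline U. of_bool (\<exists>j k. h ! s = (Some (i, j, k), True)) :: real) = (\<Sum>i'\<in>{i}. 1)"
        using f U by (intro sum.mono_neutral_cong_right) (auto simp: mpkhd_instance_def)
      then show ?thesis using f by (simp del: sum_of_bool_eq)
    next
      case False
      then show ?thesis by (auto intro!: sum.neutral[symmetric] simp del: sum_of_bool_eq)
    qed
    then have "real (successes h) = (\<Sum>s<horizon U. \<Sum>i\<in>offline U. of_bool (\<exists>j k. h ! s = (Some (i, j, k), True)))"
      using *(1) by (auto simp: real_successes simp del: sum_of_bool_eq intro!: sum.cong)
    also have "\<dots> = (\<Sum>i\<in>offline U. real (uses h i))"
      unfolding real_uses *(1) by (rule sum.swap)
    also have "\<dots> = (\<Sum>i\<in>offline U. 1 - of_bool (uses h i = 0))"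
    proof (intro sum.cong refl)
      fix i
      show "real (uses h i) = 1 - of_bool (uses h i = 0)"
        using *(2)[of i] by (auto simp: unit_capacity le_Suc_eq)
    qed
    finally show ?thesis .
  qed
  moreover have "finite (offline U)"
    using U by (simp add: mpkhd_instance_def)
  ultimately show ?thesis
    unfolding variance_successes_def
    by (subst variance_sum_of_bool[where I = "offline U" and P = "\<lambda>i h. uses h i = 0"])
      (auto simp: finite_set_outcome[OF U clairvoyant_samp] prob_unused_def state_horizon)
qed

end

text \<open>The parabola \<open>q * (1 - q)\<close> peaks at 1/2 and decreases beyond it. If
  \<gamma> \<le> 1/2, then \<open>q\<close> lies to the right of \<open>1 - \<gamma>\<close>, where
  the value is \<open>\<gamma> * (1 - \<gamma>)\<close>; otherwise the peak value 1/4 is the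
  bound.\<close>

lemma bernoulli_variance_bound:
  fixes q \<gamma> :: real
  assumes "1 - \<gamma> \<le> q"
  shows "q - q * q \<le> min (1/2) \<gamma> * (1 - min (1/2) \<gamma>)"
proof (cases "\<gamma> \<le> 1/2")
  case True
  \<comment> \<open>This product equals the difference of \<open>\<gamma> * (1 - \<gamma>)\<close>
    and \<open>q * (1 - q)\<close>.\<close>
  have "0 \<le> (q + \<gamma> - 1) * (q - \<gamma>)"
    using assms True by (intro mult_nonneg_nonneg) auto
  moreover have "min (1/2) \<gamma> = \<gamma>"
    using True by simp
  ultimately show ?thesis
    by (simp only:) (simp add: algebra_simps)
next
  case False
  have "0 \<le> (q - 1/2)\<^sup>2" by simp
  then show ?thesis
    using False by (simp add: min_def power2_eq_square algebra_simps)
qed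

context unit_samp
begin

lemma prob_unused_pair_le:
  assumes "i \<noteq> k"
  shows "prob_unused {i, k} (horizon U) \<le> prob_unused {i} (horizon U) * prob_unused {k} (horizon U)"
proof -
  have rate: "rate {i, k} t = rate {i} t + rate {k} t" for t
    using rate_Un[of "{i}" "{k}" t] assms by (simp add: insert_commute)
  have "(\<Prod>t<horizon U. 1 - rate {i, k} t) \<le> (\<Prod>t<horizon U. (1 - rate {i} t) * (1 - rate {k} t))"
  proof (rule prod_mono, intro conjI)
    fix t assume "t \<in> {..<horizon U}"
    then have t: "t < horizon U" by simp
    \<comment> \<open>Multiplying the inequalities needs nonnegative factors; the joint rate is
      itself at most 1 because a round samples at most one assignment.\<close>
    show "0 \<le> 1 - rate {i, k} t"
      using rate_le_1[OF t] by simp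
    have "0 \<le> rate {i} t * rate {k} t"
      using rate_nonneg[OF t] by simp
    then show "1 - rate {i, k} t \<le> (1 - rate {i} t) * (1 - rate {k} t)"
      by (simp add: rate algebra_simps)
  qed
  then show ?thesis
    by (simp add: prob_unused_eq prod.distrib)
qed

text \<open>In each row of the covariance matrix the off-diagonal entries are nonpositive, so the
  row sum is at most the diagonal entry, a Bernoulli variance.\<close>

lemma variance_samp_le:
  "variance_successes U \<pi> \<le> min (1/2) \<gamma> * (1 - min (1/2) \<gamma>) * real (card (offline U))"
proof -
  let ?P = "\<lambda>C. prob_unused C (horizon U)"
  have fin: "finite (offline U)"
    using U by (simp add: mpkhd_instance_def)
  have "(\<Sum>k\<in>offline U. ?P {i, k} - ?P {i} * ?P {k}) \<le> min (1/2) \<gamma> * (1 - min (1/2) \<gamma>)"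
    if i: "i \<in> offline U" for i
  proof -
    have "(\<Sum>k\<in>offline U. ?P {i, k} - ?P {i} * ?P {k}) =
      ?P {i} - ?P {i} * ?P {i} + (\<Sum>k\<in>offline U - {i}. ?P {i, k} - ?P {i} * ?P {k})"
      using fin i by (simp add: sum.remove)
    also have "\<dots> \<le> ?P {i} - ?P {i} * ?P {i} + 0"
      by (intro add_left_mono sum_nonpos) (auto intro!: prob_unused_pair_le)
    also have "\<dots> \<le> min (1/2) \<gamma> * (1 - min (1/2) \<gamma>)"
      using bernoulli_variance_bound[OF prob_unused_ge[OF i order_refl]] by simp
    finally show ?thesis .
  qed
  then have "variance_successes U \<pi> \<le> (\<Sum>i\<in>offline U. min (1/2) \<gamma> * (1 - min (1/2) \<gamma>))"
    unfolding variance_samp by (rule sum_mono)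
  then show ?thesis by (simp add: mult.commute)
qed

end

section \<open>The two bounds\<close>

lemma card_offline_unit_split: "mpkhd_instance M \<Longrightarrow> card (offline (unit_split M)) = total_capacity M"
proof -
  assume "mpkhd_instance M"
  moreover have "offline (unit_split M) = (SIGMA i:offline M. {..<capacity M i})"
    by (auto simp: unit_split_def)
  ultimately show ?thesis
    by (simp add: total_capacity_def mpkhd_instance_def)
qed

lemma unit_samp_unit_split:
  assumes "0 \<le> \<gamma>" "\<gamma> \<le> 1" "mpkhd_instance M" "lp_optimal (unit_split M) x"
  shows "unit_samp \<gamma> (unit_split M) x"
  using assms mpkhd_instance_unit_split
  by unfold_locales (auto simp: lp_optimal_def unit_split_def)

lemma samp_profit_ge:
  assumes \<gamma>: "0 \<le> \<gamma>" "\<gamma> \<le> 1" and M: "mpkhd_instance M" and x: "lp_optimal (unit_split M) x"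
  shows "\<gamma> * (1 - \<gamma>) * opt_off M \<le> samp_profit \<gamma> M x"
proof -
  interpret unit_samp \<gamma> "unit_split M" x
    by (rule unit_samp_unit_split[OF assms])
  have "\<gamma> * (1 - \<gamma>) * opt_off M \<le> \<gamma> * (1 - \<gamma>) * lp_value (unit_split M) x"
    using \<gamma> opt_off_le_lp_value[OF M x] by (intro mult_left_mono) auto
  also have "\<dots> \<le> samp_profit \<gamma> M x"
    unfolding samp_profit_def by (rule expected_profit_samp_ge)
  finally show ?thesis .
qed

lemma samp_variance_le:
  assumes "0 \<le> \<gamma>" "\<gamma> \<le> 1" and M: "mpkhd_instance M" and "lp_optimal (unit_split M) x"
  shows "samp_variance \<gamma> M x \<le> min (1/2) \<gamma> * (1 - min (1/2) \<gamma>) * real (total_capacity M)"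
proof -
  interpret unit_samp \<gamma> "unit_split M" x
    by (rule unit_samp_unit_split[OF assms])
  show ?thesis
    using variance_samp_le by (simp add: samp_variance_def card_offline_unit_split[OF M])
qed

section \<open>Tight instances\<close>

text \<open>The profit is essentially all in the last round, but the low profit of the first round is
  positive, so that the LP optimum spends the remaining capacity \<open>1 - \<epsilon>\<close> there and SAMP blocks
  the last round with probability \<open>\<gamma> * (1 - \<epsilon>)\<close>.\<close>

definition two_round :: "real \<Rightarrow> (nat, nat) mpkhd" where
  "two_round \<epsilon> =
     \<lparr>offline = {0}, online = {0}, edges = {(0, 0)}, prices = [1], capacity = (\<lambda>_. 1), horizon = 2,
      arrival = (\<lambda>_. return_pmf 0), accept_prob = (\<lambda>_ t. if t = 0 then 1 else \<epsilon>),
      profit = (\<lambda>_ t. if t = 0 then \<epsilon> else 1 / \<epsilon>)\<rparr>"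

lemma mpkhd_instance_two_round: "0 < \<epsilon> \<Longrightarrow> \<epsilon> < 1 \<Longrightarrow> mpkhd_instance (two_round \<epsilon>)"
  by (auto simp: mpkhd_instance_def two_round_def)

lemma assignments_two_round: "assignments (two_round \<epsilon>) = {(0, 0, 0)}"
  by (auto simp: assignments_def two_round_def)

lemma unit_split_two_round:
  "assignments (unit_split (two_round \<epsilon>)) = {((0, 0), 0, 0)}"
  "assignments_on (unit_split (two_round \<epsilon>)) 0 = {((0, 0), 0, 0)}"
  "assignments_off (unit_split (two_round \<epsilon>)) (0, 0) = {((0, 0), 0, 0)}"
  "offline (unit_split (two_round \<epsilon>)) = {(0, 0)}"
  "online (unit_split (two_round \<epsilon>)) = {0}"
  "horizon (unit_split (two_round \<epsilon>)) = 2"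
  "arrival (unit_split (two_round \<epsilon>)) = (\<lambda>_. return_pmf 0)"
  "accept_prob (unit_split (two_round \<epsilon>)) f t = (if t = 0 then 1 else \<epsilon>)"
  "profit (unit_split (two_round \<epsilon>)) f t = (if t = 0 then \<epsilon> else 1 / \<epsilon>)"
  by (auto simp: assignments_def assignments_on_def assignments_off_def two_round_def unit_split_def
      split: prod.split)

text \<open>With masses \<open>a\<close> and \<open>b\<close> in the two rounds, the LP maximizes
  \<open>a * \<epsilon> + b\<close> subject to \<open>a + b * \<epsilon> \<le> 1\<close>, with both
  masses in the unit interval. The optimum is unique, so every solver returns the bad
  solution.\<close>

lemma lp_optimal_two_round:
  assumes \<epsilon>: "0 < \<epsilon>" "\<epsilon> < 1" and x: "lp_optimal (unit_split (two_round \<epsilon>)) x"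
  shows "x ((0, 0), 0, 0) 0 = 1 - \<epsilon>" and "x ((0, 0), 0, 0) 1 = 1"
proof -
  let ?U = "unit_split (two_round \<epsilon>)"
  define a where "a = x ((0, 0), 0, 0) 0"
  define b where "b = x ((0, 0), 0, 0) 1"
  have feasible: "lp_feasible ?U y \<longleftrightarrow>
    (let a = y ((0, 0), 0, 0) 0; b = y ((0, 0), 0, 0) 1 in
      a \<le> 1 \<and> b \<le> 1 \<and> a + b * \<epsilon> \<le> 1 \<and> 0 \<le> a \<and> 0 \<le> b)" for y
    by (auto simp: lp_feasible_def unit_split_two_round All_less_Suc Let_def numeral_2_eq_2)
  have val: "lp_value ?U y = y ((0, 0), 0, 0) 0 * \<epsilon> + y ((0, 0), 0, 0) 1" for y
    using \<epsilon> by (simp add: lp_value_def unit_split_two_round numeral_2_eq_2)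
  have ab: "b \<le> 1" "a + b * \<epsilon> \<le> 1"
    using x by (simp_all add: lp_optimal_def feasible Let_def a_def b_def)
  have "lp_feasible ?U (\<lambda>_ t. if t = 0 then 1 - \<epsilon> else 1)"
    using \<epsilon> by (simp add: feasible Let_def)
  then have "(1 - \<epsilon>) * \<epsilon> + 1 \<le> a * \<epsilon> + b"
    using x by (auto simp: lp_optimal_def val a_def b_def)
  \<comment> \<open>Adding \<epsilon> times the offline constraint eliminates \<open>a\<close> and
    leaves an inequality for \<open>b\<close> alone.\<close>
  moreover have "(a + b * \<epsilon>) * \<epsilon> \<le> 1 * \<epsilon>"
    using ab(2) \<epsilon> by (intro mult_right_mono) auto
  ultimately have "0 \<le> (b - 1) * (1 - \<epsilon> * \<epsilon>)"
    by (simp add: algebra_simps)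
  moreover have "\<epsilon> * \<epsilon> < 1 * 1"
    using \<epsilon> by (intro mult_strict_mono) auto
  ultimately have "1 \<le> b"
    by (simp add: zero_le_mult_iff)
  then have b: "b = 1" using ab by simp
  moreover have "(1 - \<epsilon>) * \<epsilon> \<le> a * \<epsilon>"
    using \<open>(1 - \<epsilon>) * \<epsilon> + 1 \<le> a * \<epsilon> + b\<close> b by simp
  then have "1 - \<epsilon> \<le> a"
    using \<epsilon> by simp
  ultimately show "x ((0, 0), 0, 0) 0 = 1 - \<epsilon>" "x ((0, 0), 0, 0) 1 = 1"
    using ab by (simp_all add: a_def b_def)
qed

text \<open>Waiting for the last round earns \<open>1 / \<epsilon>\<close> with probability
  \<epsilon>.\<close>

lemma opt_off_two_round_ge:
  assumes \<epsilon>: "0 < \<epsilon>" "\<epsilon> < 1"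
  shows "1 \<le> opt_off (two_round \<epsilon>)"
proof -
  let ?M = "two_round \<epsilon>" and ?f = "(0, 0, 0) :: (nat, nat) assignment"
  note M = mpkhd_instance_two_round[OF \<epsilon>]
  \<comment> \<open>The test \<open>js 1 = 0\<close> keeps the policy admissible on arrival
    sequences of probability 0, over which \<open>clairvoyant_policy\<close> also
    quantifies.\<close>
  define \<pi> :: "(nat, nat) policy" where "\<pi> = (\<lambda>js h. return_pmf
    (if length h = 1 \<and> js 1 = 0 \<and> uses h 0 = 0 then Some ?f else None))"
  have \<pi>: "clairvoyant_policy ?M \<pi>"
    by (auto simp: clairvoyant_policy_def \<pi>_def allowed_decisions_def assignments_on_def
        assignments_two_round) (simp_all add: two_round_def)
  have "decision ?M \<pi> 1 = bind_pmf (arrivals ?M) (\<lambda>js. return_pmf (Some ?f))"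
    unfolding decision_def
  proof (intro bind_pmf_cong refl)
    fix js assume "js \<in> set_pmf (arrivals ?M)"
    then have "js 1 = 0"
      by (auto simp: arrivals_def set_Pi_pmf PiE_dflt_def two_round_def)
    then show "bind_pmf (run ?M \<pi> js 1) (\<pi> js) = return_pmf (Some ?f)"
      by (simp add: \<pi>_def bind_return_pmf uses_def)
  qed
  then have dec: "decision ?M \<pi> 1 = return_pmf (Some ?f)" by simp
  have "expected_profit ?M \<pi> = pmf (decision ?M \<pi> 0) (Some ?f) * \<epsilon> + 1"
    using \<epsilon> dec by (simp add: expected_profit_eq[OF M \<pi>] assignments_two_round)
      (simp add: two_round_def numeral_2_eq_2)
  then have "1 \<le> expected_profit ?M \<pi>"
    using \<epsilon> by simp
  also have "\<dots> \<le> opt_off ?M"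
    by (rule expected_profit_le_opt_off[OF M \<pi>])
  finally show ?thesis .
qed

lemma samp_profit_two_round:
  assumes \<gamma>: "0 \<le> \<gamma>" "\<gamma> \<le> 1" and \<epsilon>: "0 < \<epsilon>" "\<epsilon> < 1"
    and x: "lp_optimal (unit_split (two_round \<epsilon>)) x"
  shows "samp_profit \<gamma> (two_round \<epsilon>) x = \<gamma> * (1 - \<epsilon>) * \<epsilon> + \<gamma> * (1 - \<gamma> * (1 - \<epsilon>))"
proof -
  interpret unit_samp \<gamma> "unit_split (two_round \<epsilon>)" x
    by (rule unit_samp_unit_split[OF \<gamma> mpkhd_instance_two_round[OF \<epsilon>] x])
  have "rate {(0, 0)} 0 = \<gamma> * (1 - \<epsilon>)"
    by (simp add: rate_def unit_split_two_round lp_optimal_two_round[OF \<epsilon> x] conj_commute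
        cong: conj_cong)
  then have "prob_unused {(0, 0)} 0 = 1" "prob_unused {(0, 0)} 1 = 1 - \<gamma> * (1 - \<epsilon>)"
    by (simp_all add: prob_unused_eq unit_split_two_round)
  then show ?thesis
    using \<epsilon> lp_optimal_two_round[OF \<epsilon> x]
    by (simp add: samp_profit_def expected_profit_samp unit_split_two_round numeral_2_eq_2)
qed

text \<open>As \<epsilon> tends to 0, the profit on \<open>two_round \<epsilon>\<close> approaches
  \<open>\<gamma> * (1 - \<gamma>)\<close> while the optimum stays at least 1. In the extended reals
  the infimum needs no boundedness argument.\<close>

lemma INF_samp_ratio:
  assumes \<gamma>: "0 \<le> \<gamma>" "\<gamma> \<le> 1" and sol: "lp_solver sol"
  shows "(INF M\<in>{M :: (nat, nat) mpkhd. mpkhd_instance M \<and> opt_off M > 0}.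
    ereal (samp_profit \<gamma> M (sol M) / opt_off M)) = ereal (\<gamma> * (1 - \<gamma>))"
    (is "(INF M\<in>?I. ?r M) = _")
proof (rule antisym)
  show "ereal (\<gamma> * (1 - \<gamma>)) \<le> (INF M\<in>?I. ?r M)"
    using samp_profit_ge[OF \<gamma>] sol
    by (intro INF_greatest) (auto simp: lp_solver_def pos_le_divide_eq)
  show "(INF M\<in>?I. ?r M) \<le> ereal (\<gamma> * (1 - \<gamma>))"
  proof (rule ereal_le_epsilon2)
    fix e :: real assume e: "0 < e"
    \<comment> \<open>The profit exceeds \<open>\<gamma> * (1 - \<gamma>)\<close> by at most
      \<open>2 * \<epsilon>\<close>, one \<epsilon> from each round; the cap 1/2 keeps \<epsilon>
      below 1.\<close>
    define \<epsilon> where "\<epsilon> = min (1/2) (e/2)"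
    have \<epsilon>: "0 < \<epsilon>" "\<epsilon> < 1" "2 * \<epsilon> \<le> e"
      using e by (auto simp: \<epsilon>_def)
    note M = mpkhd_instance_two_round[OF \<epsilon>(1,2)]
    have x: "lp_optimal (unit_split (two_round \<epsilon>)) (sol (two_round \<epsilon>))"
      using sol M by (auto simp: lp_solver_def)
    let ?p = "samp_profit \<gamma> (two_round \<epsilon>) (sol (two_round \<epsilon>))"
    have opt: "1 \<le> opt_off (two_round \<epsilon>)"
      by (rule opt_off_two_round_ge[OF \<epsilon>(1,2)])
    have p: "?p = \<gamma> * (1 - \<epsilon>) * \<epsilon> + \<gamma> * (1 - \<gamma> * (1 - \<epsilon>))"
      by (rule samp_profit_two_round[OF \<gamma> \<epsilon>(1,2) x])
    have "\<gamma> * (1 - \<epsilon>) * \<epsilon> \<le> 1 * \<epsilon>"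
      using \<gamma> \<epsilon> by (intro mult_right_mono mult_le_one) auto
    moreover have "\<gamma> * \<gamma> * \<epsilon> \<le> 1 * \<epsilon>"
      using \<gamma> \<epsilon> by (intro mult_right_mono mult_le_one) auto
    ultimately have le: "?p \<le> \<gamma> * (1 - \<gamma>) + e"
      unfolding p using \<epsilon>(3) by (simp add: algebra_simps)
    \<comment> \<open>The profit must be nonnegative for the division by an optimum of at least 1
      not to increase it.\<close>
    have "0 \<le> \<gamma> * (1 - \<gamma>) * opt_off (two_round \<epsilon>)"
      using \<gamma> opt by simp
    then have "0 \<le> ?p"
      using samp_profit_ge[OF \<gamma> M x] by linarith
    then have "?p / opt_off (two_round \<epsilon>) \<le> ?p / 1"
      using opt by (intro divide_left_mono) auto
    then have "?r (two_round \<epsilon>) \<le> ereal (\<gamma> * (1 - \<gamma>) + e)"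
      using le by simp
    moreover have "two_round \<epsilon> \<in> ?I"
      using M opt by simp
    ultimately show "(INF M\<in>?I. ?r M) \<le> ereal (\<gamma> * (1 - \<gamma>)) + ereal e"
      by (metis (no_types, lifting) INF_lower2 plus_ereal.simps(1))
  qed
qed

text \<open>Each offline type is attempted in its own round only, which makes the successes
  independent; \<open>p\<close> will be chosen such that each has probability \<open>\<gamma> * p = min (1/2) \<gamma>\<close>.\<close>

definition diagonal :: "real \<Rightarrow> nat \<Rightarrow> (nat, nat) mpkhd" where
  "diagonal p B =
     \<lparr>offline = {..<B}, online = {..<B}, edges = {(i, i) | i. i < B}, prices = [1],
      capacity = (\<lambda>_. 1), horizon = B, arrival = return_pmf, accept_prob = (\<lambda>_ _. p),
      profit = (\<lambda>_ _. 1)\<rparr>"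

lemma mpkhd_instance_diagonal: "0 < p \<Longrightarrow> p \<le> 1 \<Longrightarrow> 0 < B \<Longrightarrow> mpkhd_instance (diagonal p B)"
  by (auto simp: mpkhd_instance_def diagonal_def)

lemma total_capacity_diagonal: "total_capacity (diagonal p B) = B"
  by (simp add: total_capacity_def diagonal_def)

lemma unit_split_diagonal:
  "assignments (unit_split (diagonal p B)) = (\<lambda>i. ((i, 0), i, 0)) ` {..<B}"
  "j < B \<Longrightarrow> assignments_on (unit_split (diagonal p B)) j = {((j, 0), j, 0)}"
  "i < B \<Longrightarrow> assignments_off (unit_split (diagonal p B)) (i, 0) = {((i, 0), i, 0)}"
  "offline (unit_split (diagonal p B)) = (\<lambda>i. (i, 0)) ` {..<B}"
  "online (unit_split (diagonal p B)) = {..<B}"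
  "horizon (unit_split (diagonal p B)) = B"
  "arrival (unit_split (diagonal p B)) = return_pmf"
  "accept_prob (unit_split (diagonal p B)) f t = p"
  "profit (unit_split (diagonal p B)) f t = 1"
  by (auto simp: assignments_def assignments_on_def assignments_off_def diagonal_def unit_split_def
      split: prod.split)

text \<open>Only type \<open>t\<close> arrives in round \<open>t\<close>, so the online constraint
  bounds \<open>x\<close> entrywise by the identity matrix. That matrix is feasible and all
  assignments have the same positive value, so an optimal \<open>x\<close> attains the bound in
  every entry.\<close>

lemma lp_optimal_diagonal:
  assumes p: "0 < p" "p \<le> 1" and x: "lp_optimal (unit_split (diagonal p B)) x"
    and it: "i < B" "t < B"
  shows "x ((i, 0), i, 0) t = of_bool (t = i)"
proof -
  let ?U = "unit_split (diagonal p B)"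
  have inj: "inj_on (\<lambda>i :: nat. ((i, 0 :: nat), i, 0 :: nat)) A" for A
    by (auto simp: inj_on_def)
  have val: "lp_value ?U y = p * (\<Sum>t<B. \<Sum>i<B. y ((i, 0), i, 0) t)" for y
    by (simp add: lp_value_def unit_split_diagonal sum.reindex[OF inj] sum_distrib_left mult.commute)
  have "lp_feasible ?U (\<lambda>f t. of_bool (t = fst (fst f)))"
    using p by (auto simp: lp_feasible_def unit_split_diagonal simp flip: sum_distrib_right)
  then have "p * (\<Sum>t<B. \<Sum>i<B. of_bool (t = i)) \<le> p * (\<Sum>t<B. \<Sum>i<B. x ((i, 0), i, 0) t)"
    using x by (auto simp: lp_optimal_def val simp del: sum_of_bool_eq)
  \<comment> \<open>The total gap is nonpositive by optimality and every single gap is nonnegative,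
    so all gaps vanish.\<close>
  then have "(\<Sum>t<B. \<Sum>i<B. of_bool (t = i) - x ((i, 0), i, 0) t) \<le> 0"
    using p by (simp add: sum_subtractf del: sum_of_bool_eq)
  moreover have le: "0 \<le> of_bool (t = i) - x ((i, 0), i, 0) t" if "i < B" "t < B" for i t
  proof -
    have "lp_feasible ?U x" using x by (simp add: lp_optimal_def)
    then have "x ((i, 0), i, 0) t \<le> indicator {i} t"
      using that by (simp add: lp_feasible_def unit_split_diagonal)
    then show ?thesis by (simp add: indicator_def of_bool_def)
  qed
  then have nn: "0 \<le> (\<Sum>i<B. of_bool (t = i) - x ((i, 0), i, 0) t)" if "t < B" for t
    using that by (intro sum_nonneg) auto
  ultimately have "(\<Sum>t<B. \<Sum>i<B. of_bool (t = i) - x ((i, 0), i, 0) t) = 0"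
    by (intro antisym[OF _ sum_nonneg]) auto
  then have "(\<Sum>i<B. of_bool (t = i) - x ((i, 0), i, 0) t) = 0"
    using nn it by (subst (asm) sum_nonneg_eq_0_iff) auto
  then show ?thesis
    using le it by (subst (asm) sum_nonneg_eq_0_iff) auto
qed

lemma samp_variance_diagonal:
  assumes \<gamma>: "0 \<le> \<gamma>" "\<gamma> \<le> 1" and p: "0 < p" "p \<le> 1" and B: "0 < B"
    and x: "lp_optimal (unit_split (diagonal p B)) x"
  shows "samp_variance \<gamma> (diagonal p B) x = \<gamma> * p * (1 - \<gamma> * p) * real B"
proof -
  interpret unit_samp \<gamma> "unit_split (diagonal p B)" x
    by (rule unit_samp_unit_split[OF \<gamma> mpkhd_instance_diagonal[OF p B] x])
  let ?P = "\<lambda>C. prob_unused C B"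
  have rate: "rate {(i, 0)} t = (if t = i then \<gamma> * p else 0)" if "i < B" "t < B" for i t
  proof -
    have "{f \<in> assignments (unit_split (diagonal p B)). fst f \<in> {(i, 0)}} = {((i, 0), i, 0)}"
      using that by (auto simp: unit_split_diagonal)
    then show ?thesis
      using lp_optimal_diagonal[OF p x that] by (simp add: rate_def unit_split_diagonal)
  qed
  have prod: "(\<Prod>t<B. 1 - (if t = i then a else 0)) = 1 - a" if "i < B" for i and a :: real
    using that prod.delta[of "{..<B}" i "\<lambda>_. 1 - a"]
    by (simp add: if_distrib[of "\<lambda>b. 1 - b"] cong: if_cong)
  have single: "?P {(i, 0)} = 1 - \<gamma> * p" if "i < B" for i
    using that by (simp add: prob_unused_eq unit_split_diagonal rate prod)
  have pair: "?P {(i, 0), (k, 0)} = ?P {(i, 0)} * ?P {(k, 0)}" if "i < B" "k < B" "i \<noteq> k" for i k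
  proof -
    have "rate {(i, 0), (k, 0)} t = rate {(i, 0)} t + rate {(k, 0)} t" for t
      using rate_Un[of "{(i, 0)}" "{(k, 0)}" t] that by (simp add: insert_commute)
    \<comment> \<open>In every round at most one of the two rates is nonzero, so the cross term
      vanishes and the covariance is 0.\<close>
    then have "1 - rate {(i, 0), (k, 0)} t = (1 - rate {(i, 0)} t) * (1 - rate {(k, 0)} t)"
      if "t < B" for t
      using \<open>i < B\<close> \<open>k < B\<close> \<open>i \<noteq> k\<close> that by (simp add: rate)
    then show ?thesis
      by (simp add: prob_unused_eq unit_split_diagonal flip: prod.distrib)
  qed
  have inj: "inj_on (\<lambda>i :: nat. (i, 0 :: nat)) A" for A
    by (auto simp: inj_on_def)
  have "samp_variance \<gamma> (diagonal p B) x =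
    (\<Sum>i<B. \<Sum>k<B. ?P {(i, 0), (k, 0)} - ?P {(i, 0)} * ?P {(k, 0)})"
    unfolding samp_variance_def variance_samp unit_split_diagonal
    by (simp add: sum.reindex[OF inj])
  also have "\<dots> = (\<Sum>i<B. \<Sum>k<B. if i = k then \<gamma> * p * (1 - \<gamma> * p) else 0)"
    by (intro sum.cong refl) (auto simp: single pair algebra_simps)
  finally show ?thesis by simp
qed

lemma samp_variance_tight:
  assumes \<gamma>: "0 \<le> \<gamma>" "\<gamma> \<le> 1" and B: "0 < B"
  shows "\<exists>M :: (nat, nat) mpkhd. mpkhd_instance M \<and> total_capacity M = B \<and>
    (\<forall>x. lp_optimal (unit_split M) x \<longrightarrow>
      samp_variance \<gamma> M x = min (1/2) \<gamma> * (1 - min (1/2) \<gamma>) * real B)"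
proof -
  \<comment> \<open>For large \<gamma> the acceptance probability thins the success probability to
    1/2, where the Bernoulli variance peaks.\<close>
  define p where "p = (if \<gamma> \<le> 1/2 then 1 else 1 / (2 * \<gamma>))"
  have p: "0 < p" "p \<le> 1" "\<gamma> * p = min (1/2) \<gamma>"
    using \<gamma> by (auto simp: p_def min_def)
  show ?thesis
    using mpkhd_instance_diagonal[OF p(1,2) B] samp_variance_diagonal[OF \<gamma> p(1,2) B]
    by (intro exI[of _ "diagonal p B"]) (simp add: total_capacity_diagonal p(3))
qed

text \<open>The bounds hold for every optimal LP solution, one of which exists by
  \<open>lp_optimal_exists\<close>. Tightness holds for every way of choosing optimal solutions and
  is witnessed by instances over \<open>nat\<close>.\<close>

theorem theorem1p3:
  fixes \<gamma> :: real
  assumes "0 \<le> \<gamma>" and "\<gamma> \<le> 1"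
  shows "(\<forall>(M :: ('i, 'j) mpkhd) x. mpkhd_instance M \<longrightarrow> lp_optimal (unit_split M) x \<longrightarrow>
            samp_profit \<gamma> M x \<ge> \<gamma> * (1 - \<gamma>) * opt_off M) \<and>
         (\<forall>(M :: ('i, 'j) mpkhd) x. mpkhd_instance M \<longrightarrow> lp_optimal (unit_split M) x \<longrightarrow>
            samp_variance \<gamma> M x
              \<le> min (1/2) \<gamma> * (1 - min (1/2) \<gamma>) * real (total_capacity M)) \<and>
         (\<forall>sol :: (nat, nat) mpkhd \<Rightarrow> (nat \<times> nat, nat) assignment \<Rightarrow> nat \<Rightarrow> real.
            lp_solver sol \<longrightarrow>
            (INF M\<in>{M. mpkhd_instance M \<and> opt_off M > 0}.
               ereal (samp_profit \<gamma> M (sol M) / opt_off M)) = ereal (\<gamma> * (1 - \<gamma>))) \<and>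
         (\<forall>B::nat. B > 0 \<longrightarrow>
            (\<exists>M :: (nat, nat) mpkhd. mpkhd_instance M \<and> total_capacity M = B \<and>
               (\<forall>x. lp_optimal (unit_split M) x \<longrightarrow>
                  samp_variance \<gamma> M x = min (1/2) \<gamma> * (1 - min (1/2) \<gamma>) * real B)))"
  using samp_profit_ge[OF assms] samp_variance_le[OF assms] INF_samp_ratio[OF assms]
    samp_variance_tight[OF assms]
  by blast

end
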